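(* Let $(X,\mu)$ be a standard non-atomic probability space and let $S\in\mathrm{Aut}(X,\mu)$ be an ergodic transformation such that for every $n\ge 2$, $S^n$ is not ergodic. Let $\omega\colon\mathbb{R}_+\to\mathbb{R}_+$ be a sublinear map. Then there exists $T\in\mathrm{Aut}(X,\mu)$ such that $S$ and $T$ are $\omega$-integrably orbit equivalent but not flip-conjugate.
   Context: $\mathrm{Aut}(X,\mu)$ is the group of probability-measure-preserving bijections of $(X,\mu)$ up to equality almost everywhere. A map $\omega\colon\mathbb{R}_+\to\mathbb{R}_+$ is sublinear if $\lim_{r\to\infty}\omega(r)/r=0$. An orbit equivalence between free ergodic $T\in\mathrm{Aut}(X,\mu)$ and $S\in\mathrm{Aut}(Y,\nu)$ is a measure isomorphism $\varphi\colon X\to Y$ for which there exist (measurable) maps $c_T\colon X\to\mathbb{Z}$, $c_S\colon Y\to\mathbb{Z}$ (orbit cocycles) with $\varphi(Tx)=S^{c_T(x)}\varphi(x)$ and $\varphi^{-1}(Sy)=T^{c_S(y)}\varphi^{-1}(y)$ almost surely. The transformations $T$ and $S$ are $\omega$-integrably orbit equivalent if an orbit equivalence $\varphi$ between them can be chosen so that $\int_X\omega(|c_T(x)|)\,d\mu(x)<\infty$ and $\int_Y\omega(|c_S(y)|)\,d\nu(y)<\infty$. $S$ and $T$ are flip-conjugate if $S$ is conjugate (by a measure isomorphism) to $T$ or to $T^{-1}$. *)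

theory Defs
  imports "HOL-Probability.Probability"
begin

text \<open>The measurable sets are the Borel sets of a Polish topology on the underlying set
  (they are not completed with respect to the measure).\<close>

definition standard_borel :: "'a measure \<Rightarrow> bool" where
  "standard_borel M \<longleftrightarrow>
     (\<exists>X. completely_metrizable_space X \<and> second_countable X \<and> topspace X = space M \<and>
          sets M = sigma_sets (space M) {U. openin X U})"

definition non_atomic :: "'a measure \<Rightarrow> bool" where
  "non_atomic M \<longleftrightarrow>
     (\<forall>A\<in>sets M. 0 < emeasure M A \<longrightarrow>
        (\<exists>B\<in>sets M. B \<subseteq> A \<and> 0 < emeasure M B \<and> emeasure M B < emeasure M A))"

definition standard_nonatomic_prob_space :: "'a measure \<Rightarrow> bool" where
  "standard_nonatomic_prob_space M \<longleftrightarrow> prob_space M \<and> standard_borel M \<and> non_atomic M"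

text \<open>Elements of the automorphism group are given by representatives that are bimeasurable,
  measure-preserving bijections of the whole space.  There is no quotient by equality almost
  everywhere: every property below is insensitive to changing a representative on a null set.
  Values of a representative outside the space are irrelevant.\<close>

definition Aut :: "'a measure \<Rightarrow> ('a \<Rightarrow> 'a) set" where
  "Aut M = {T. T \<in> measurable M M \<and> bij_betw T (space M) (space M) \<and>
               the_inv_into (space M) T \<in> measurable M M \<and> distr M M T = M}"

definition int_iter :: "'a measure \<Rightarrow> ('a \<Rightarrow> 'a) \<Rightarrow> int \<Rightarrow> 'a \<Rightarrow> 'a" where
  "int_iter M T k =
     (if 0 \<le> k then T ^^ nat k else the_inv_into (space M) T ^^ nat (- k))"

definition ergodic :: "'a measure \<Rightarrow> ('a \<Rightarrow> 'a) \<Rightarrow> bool" where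
  "ergodic M T \<longleftrightarrow>
     (\<forall>A\<in>sets M. T -` A \<inter> space M = A \<longrightarrow> measure M A = 0 \<or> measure M A = 1)"

definition free :: "'a measure \<Rightarrow> ('a \<Rightarrow> 'a) \<Rightarrow> bool" where
  "free M T \<longleftrightarrow> (AE x in M. \<forall>k::int. k \<noteq> 0 \<longrightarrow> int_iter M T k x \<noteq> x)"

text \<open>A measure isomorphism is a bijection between conull sets; it is given here together with
  its almost everywhere defined inverse, as a pair of measurable maps on the whole spaces.
  That \<open>g\<close> is measure-preserving follows from the other conditions.\<close>

definition measure_iso :: "'a measure \<Rightarrow> 'b measure \<Rightarrow> ('a \<Rightarrow> 'b) \<Rightarrow> ('b \<Rightarrow> 'a) \<Rightarrow> bool" where
  "measure_iso M N f g \<longleftrightarrow>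
     f \<in> measurable M N \<and> g \<in> measurable N M \<and> distr M N f = N \<and>
     (AE x in M. g (f x) = x) \<and> (AE y in N. f (g y) = y)"

definition conjugate :: "'a measure \<Rightarrow> ('a \<Rightarrow> 'a) \<Rightarrow> 'b measure \<Rightarrow> ('b \<Rightarrow> 'b) \<Rightarrow> bool" where
  "conjugate M S N T \<longleftrightarrow> (\<exists>f g. measure_iso M N f g \<and> (AE x in M. f (S x) = T (f x)))"

definition flip_conjugate :: "'a measure \<Rightarrow> ('a \<Rightarrow> 'a) \<Rightarrow> 'b measure \<Rightarrow> ('b \<Rightarrow> 'b) \<Rightarrow> bool" where
  "flip_conjugate M S N T \<longleftrightarrow>
     conjugate M S N T \<or> conjugate M S N (the_inv_into (space N) T)"

text \<open>The pair \<open>f, g\<close> is an orbit equivalence with its inverse, and \<open>cT, cS\<close> are its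
  orbit cocycles.\<close>

definition orbit_equivalence ::
  "'a measure \<Rightarrow> ('a \<Rightarrow> 'a) \<Rightarrow> 'b measure \<Rightarrow> ('b \<Rightarrow> 'b) \<Rightarrow>
   ('a \<Rightarrow> 'b) \<Rightarrow> ('b \<Rightarrow> 'a) \<Rightarrow> ('a \<Rightarrow> int) \<Rightarrow> ('b \<Rightarrow> int) \<Rightarrow> bool" where
  "orbit_equivalence M T N S f g cT cS \<longleftrightarrow>
     measure_iso M N f g \<and>
     cT \<in> measurable M (count_space UNIV) \<and> cS \<in> measurable N (count_space UNIV) \<and>
     (AE x in M. f (T x) = int_iter N S (cT x) (f x)) \<and>
     (AE y in N. g (S y) = int_iter M T (cS y) (g y))"

text \<open>Orbit equivalence is a relation between free ergodic transformations.\<close>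

definition integrably_orbit_equivalent ::
  "(real \<Rightarrow> real) \<Rightarrow> 'a measure \<Rightarrow> ('a \<Rightarrow> 'a) \<Rightarrow> 'b measure \<Rightarrow> ('b \<Rightarrow> 'b) \<Rightarrow> bool" where
  "integrably_orbit_equivalent \<omega> M T N S \<longleftrightarrow>
     T \<in> Aut M \<and> free M T \<and> ergodic M T \<and>
     S \<in> Aut N \<and> free N S \<and> ergodic N S \<and>
     (\<exists>f g cT cS. orbit_equivalence M T N S f g cT cS \<and>
        (\<integral>\<^sup>+x. ennreal (\<omega> (real_of_int \<bar>cT x\<bar>)) \<partial>M) < \<infinity> \<and>
        (\<integral>\<^sup>+y. ennreal (\<omega> (real_of_int \<bar>cS y\<bar>)) \<partial>N) < \<infinity>)"

text \<open>The first conjunct says that \<open>\<omega>\<close> maps the nonnegative reals to themselves;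
  values at negative arguments are never used.\<close>

definition sublinear :: "(real \<Rightarrow> real) \<Rightarrow> bool" where
  "sublinear \<omega> \<longleftrightarrow> (\<forall>r\<ge>0. 0 \<le> \<omega> r) \<and> ((\<lambda>r. \<omega> r / r) \<longlongrightarrow> 0) at_top"

end

theory Submission
  imports Defs
begin

text \<open>Since no power \<open>S\<^sup>n\<close> with \<open>n \<ge> 2\<close> is ergodic, \<open>S\<close> factors onto a cyclic rotation of every prime order.
  Combining large odd primes gives compatible position maps \<open>s\<^sub>k\<close> onto the integers modulo \<open>h\<^sub>k\<close>,
  with \<open>h\<^sub>k\<close> odd and growing as fast as desired; they cut the orbits into nested blocks, each block
  of length \<open>h\<^sub>k\<^sub>+\<^sub>1\<close> consisting of \<open>q\<^sub>k\<close> blocks of length \<open>h\<^sub>k\<close>.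
  For a set \<open>E\<close> of natural numbers let \<open>T\<^sub>E\<close> run through the orbits of \<open>S\<close> in the order in which,
  for \<open>k \<in> E\<close>, neighbouring subblocks in about the first half of each block of length \<open>h\<^sub>k\<^sub>+\<^sub>1\<close>
  are swapped in pairs.  Both cocycles exceed the scale of \<open>h\<^sub>k\<close> only with probability about
  \<open>1 / h\<^sub>k\<close>, so they are \<open>\<omega>\<close>-integrable when \<open>h\<^sub>k\<close> grows fast.

  As \<open>S\<^sup>2\<close> is not ergodic, some set is exchanged with its complement by \<open>S\<close>.  If every \<open>T\<^sub>E\<close> were
  flip-conjugate to \<open>S\<close>, each would have such an alternating set \<open>A\<^sub>E\<close>.  Because \<open>h\<^sub>k\<close> is odd, a swap
  of subblocks changes parities, and for \<open>E \<noteq> F\<close> this forces \<open>A\<^sub>E\<close> and \<open>A\<^sub>F\<close> to differ by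
  measure at least \<open>1/7\<close>: too many separated sets for a separable measure algebra.\<close>

section \<open>Shuffled positions in nested blocks\<close>

definition pair_swap :: "int \<Rightarrow> int \<Rightarrow> int" where
  "pair_swap c j = (if 0 \<le> j \<and> j < 2 * c then if even j then j + 1 else j - 1 else j)"

lemma pair_swap_involutive [simp]: "pair_swap c (pair_swap c j) = j"
  unfolding pair_swap_def by (auto elim!: evenE oddE)

lemma pair_swap_near: "\<bar>pair_swap c j - j\<bar> \<le> 1"
  by (auto simp: pair_swap_def)

lemma pair_swap_range:
  assumes "0 \<le> j" "j < n" "2 * c \<le> n"
  shows "0 \<le> pair_swap c j \<and> pair_swap c j < n"
  using assms unfolding pair_swap_def by (auto elim!: evenE oddE)

lemma even_pair_swap: "0 \<le> j \<Longrightarrow> even (pair_swap c j) \<longleftrightarrow> (even j \<longleftrightarrow> \<not> j < 2 * c)"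
  by (auto simp: pair_swap_def)

text \<open>Oddness keeps every \<open>h k\<close> odd, so that moving by an odd number of blocks of
  length \<open>h k\<close> changes parity. The bound 5 makes the swapped zone of
  \<open>2 * (q k div 4)\<close> subblocks at least two sevenths of a block, the worst case being
  \<open>q k = 7\<close>.\<close>

locale block_lengths =
  fixes q :: "nat \<Rightarrow> int"
  assumes q_ge: "5 \<le> q k" and q_odd: "odd (q k)"
begin

definition h :: "nat \<Rightarrow> int" where
  "h k = (\<Prod>i<k. q i)"

lemma h_0 [simp]: "h 0 = 1" and h_Suc: "h (Suc k) = h k * q k"
  by (simp_all add: h_def)

lemma odd_h: "odd (h k)"
  by (induction k) (auto simp: h_Suc q_odd)

lemma h_gt: "int k < h k"
proof (induction k)
  case (Suc k)
  have "h k * 5 \<le> h k * q k"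
    using Suc q_ge[of k] by (intro mult_left_mono) auto
  then show ?case
    unfolding h_Suc using Suc by linarith
qed simp

lemma h_pos [simp]: "0 < h k"
  using h_gt[of k] by linarith

lemma h_nonneg [simp]: "0 \<le> h k"
  using h_pos[of k] by linarith

lemma h_nz [simp]: "h k \<noteq> 0"
  using h_pos[of k] by linarith

text \<open>The swapped pairs fill at most the first half of the \<open>q k\<close> digits, which
  leaves at least as many fixed digits to compare them with.\<close>

definition shuffle :: "nat set \<Rightarrow> nat \<Rightarrow> int \<Rightarrow> int" where
  "shuffle E k j = (if k \<in> E then pair_swap (q k div 4) j else j)"

lemma shuffle_involutive [simp]: "shuffle E k (shuffle E k j) = j"
  by (simp add: shuffle_def)

lemma shuffle_near: "\<bar>shuffle E k j - j\<bar> \<le> 1"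
  by (simp add: shuffle_def pair_swap_near)

lemma shuffle_range: "0 \<le> j \<Longrightarrow> j < q k \<Longrightarrow> 0 \<le> shuffle E k j \<and> shuffle E k j < q k"
  using pair_swap_range[of j "q k" "q k div 4"] q_ge[of k] by (auto simp: shuffle_def)

text \<open>In the mixed radix expansion with bases \<open>q 0\<close>, \<open>q 1\<close>, and so
  on, this applies \<open>shuffle E l\<close> to each digit \<open>l\<close> below \<open>k\<close>
  separately. Hence it is an involution of \<open>{0..<h k}\<close> that is compatible between
  levels.\<close>

primrec perm :: "nat set \<Rightarrow> nat \<Rightarrow> int \<Rightarrow> int" where
  "perm E 0 i = i"
| "perm E (Suc k) i = perm E k (i mod h k) + h k * shuffle E k (i div h k)"

lemma block_range:
  assumes "0 \<le> i" "i < h k" "0 \<le> j" "j < q k"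
  shows "0 \<le> i + h k * j \<and> i + h k * j < h (Suc k)"
proof -
  have "h k * j \<le> h k * (q k - 1)"
    using assms by (intro mult_left_mono) auto
  then show ?thesis
    using assms by (simp add: h_Suc algebra_simps)
qed

lemma div_h_range:
  assumes "0 \<le> i" "i < h (Suc k)"
  shows "0 \<le> i div h k \<and> i div h k < q k"
proof -
  have "h k * (i div h k) \<le> i"
    using pos_mod_sign[OF h_pos, of i k] mult_div_mod_eq[of "h k" i] by linarith
  then have "h k * (i div h k) < h k * q k"
    using assms(2) unfolding h_Suc by linarith
  then have "i div h k < q k"
    by (rule mult_left_less_imp_less) simp
  then show ?thesis
    using assms by (simp add: pos_imp_zdiv_nonneg_iff)
qed

lemma perm_block:
  assumes "0 \<le> i" "i < h k"
  shows "perm E (Suc k) (i + h k * j) = perm E k i + h k * shuffle E k j"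
  using assms by simp

lemma perm_range: "0 \<le> i \<Longrightarrow> i < h k \<Longrightarrow> 0 \<le> perm E k i \<and> perm E k i < h k"
proof (induction k arbitrary: i)
  case (Suc k)
  have "0 \<le> perm E k (i mod h k) \<and> perm E k (i mod h k) < h k"
    by (intro Suc.IH) auto
  with block_range shuffle_range div_h_range[OF Suc.prems] show ?case
    by simp
qed simp

lemma perm_involutive: "0 \<le> i \<Longrightarrow> i < h k \<Longrightarrow> perm E k (perm E k i) = i"
proof (induction k arbitrary: i)
  case (Suc k)
  have r: "0 \<le> perm E k (i mod h k) \<and> perm E k (i mod h k) < h k"
    by (intro perm_range) auto
  have "perm E k (perm E k (i mod h k)) = i mod h k"
    by (intro Suc.IH) auto
  then show ?case
    using r by simp
qed simp

lemma perm_inj: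
  assumes "0 \<le> i" "i < h k" "0 \<le> j" "j < h k" "perm E k i = perm E k j"
  shows "i = j"
  using assms by (metis perm_involutive)

text \<open>Crossing the end of an \<open>h k\<close> block changes the low part by less than
  \<open>h k\<close>. The two consecutive quotients are each shuffled by at most 1, so they end up
  at most 3 apart.\<close>

lemma perm_step_le:
  assumes "i mod h k = h k - 1"
  shows "\<bar>perm E (Suc k) (i + 1) - perm E (Suc k) i\<bar> \<le> 4 * h k"
proof -
  let ?j = "i div h k"
  have i: "i = (h k - 1) + h k * ?j"
    using assms by (metis mod_mult_div_eq)
  have i1: "i + 1 = 0 + h k * (?j + 1)"
    by (subst i) (simp add: algebra_simps)
  have "perm E (Suc k) (i + 1) - perm E (Suc k) i
      = perm E k 0 - perm E k (h k - 1) + h k * (shuffle E k (?j + 1) - shuffle E k ?j)"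
    unfolding i1 perm_block[OF order_refl h_pos]
    by (subst (2) i, subst perm_block) (simp_all add: algebra_simps int_one_le_iff_zero_less)
  moreover have "\<bar>h k * (shuffle E k (?j + 1) - shuffle E k ?j)\<bar> \<le> h k * 3"
    using shuffle_near[of E k ?j] shuffle_near[of E k "?j + 1"]
    unfolding abs_mult by (intro mult_mono) auto
  moreover have "0 \<le> perm E k 0 \<and> perm E k 0 < h k" "0 \<le> perm E k (h k - 1) \<and> perm E k (h k - 1) < h k"
    using h_pos[of k] by (intro perm_range; linarith)+
  ultimately show ?thesis
    by linarith
qed

text \<open>Only one of the two shuffles moves anything at level \<open>k\<close>, and a swap within
  a pair always changes parity.\<close>

lemma even_shuffle_eq_iff:
  assumes "0 \<le> j" "k \<in> E \<longleftrightarrow> k \<notin> F"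
  shows "even (shuffle E k j + shuffle F k j) \<longleftrightarrow> \<not> j < 2 * (q k div 4)"
  using assms even_pair_swap[of j "q k div 4"] by (auto simp: shuffle_def)

end

section \<open>Actions of the integers\<close>

text \<open>Working with all powers at once turns compositions along an orbit into additions of
  exponents. The laws are confined to \<open>space M\<close> because a representative may take any
  values elsewhere.\<close>

locale int_action = prob_space M for M :: "'a measure" +
  fixes a :: "int \<Rightarrow> 'a \<Rightarrow> 'a"
  assumes action_measurable [measurable]: "\<And>n. a n \<in> measurable M M"
    and action_0: "\<And>x. x \<in> space M \<Longrightarrow> a 0 x = x"
    and action_add: "\<And>m n x. x \<in> space M \<Longrightarrow> a (m + n) x = a m (a n x)"
    and distr_action: "\<And>n. distr M M (a n) = M"
begin

lemma action_space [simp]: "x \<in> space M \<Longrightarrow> a n x \<in> space M"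
  using measurable_space[OF action_measurable] .

lemma action_inverse:
  assumes "x \<in> space M"
  shows "a n (a (- n) x) = x" "a (- n) (a n x) = x"
  using assms action_add[of x n "- n"] action_add[of x "- n" n] by (simp_all add: action_0)

lemma bij_betw_action: "bij_betw (a n) (space M) (space M)"
  by (rule bij_betw_byWitness[of _ "a (- n)"]) (auto simp: action_inverse)

lemma the_inv_action:
  assumes "x \<in> space M"
  shows "the_inv_into (space M) (a n) x = a (- n) x"
  using assms by (intro the_inv_into_f_eq bij_betw_imp_inj_on[OF bij_betw_action])
    (auto simp: action_inverse)

lemma action_Aut: "a n \<in> Aut M"
proof -
  have "the_inv_into (space M) (a n) \<in> measurable M M"
    by (subst measurable_cong[OF the_inv_action]) auto
  then show ?thesis
    by (simp add: Aut_def bij_betw_action distr_action)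
qed

lemma int_iter_action:
  assumes "x \<in> space M"
  shows "int_iter M (a 1) n x = a n x"
proof -
  have f: "(a 1 ^^ k) x = a (int k) x" for k
  proof (induction k)
    case (Suc k)
    then show ?case
      using action_add[OF assms, of 1 "int k"] by (simp add: add.commute)
  qed (simp add: action_0 assms)
  have b: "(the_inv_into (space M) (a 1) ^^ k) x = a (- int k) x" for k
  proof (induction k)
    case (Suc k)
    then show ?case
      using action_add[OF assms, of "-1" "- int k"]
      by (simp add: the_inv_action assms)
  qed (simp add: action_0 assms)
  show ?thesis
    by (simp add: int_iter_def f b)
qed

lemma AE_action:
  assumes "AE x in M. P x"
  shows "AE x in M. P (a n x)"
proof -
  have "AE x in distr M M (a n). P x"
    using assms by (subst distr_action)
  then show ?thesis
    by (rule AE_distrD[rotated]) simp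
qed

lemma emeasure_action_vimage:
  assumes "A \<in> sets M"
  shows "emeasure M (a n -` A \<inter> space M) = emeasure M A"
  using emeasure_distr[of "a n" M M A] assms by (simp add: distr_action)

text \<open>A map moving each point along its orbit preserves the measure as soon as the displacement
  can be read off the image point.\<close>

lemma distr_displacement:
  assumes c [measurable]: "c \<in> measurable M (count_space UNIV)"
    and c' [measurable]: "c' \<in> measurable M (count_space UNIV)"
    and eq: "\<And>x n. x \<in> space M \<Longrightarrow> c x = n \<longleftrightarrow> c' (a n x) = n"
  shows "distr M M (\<lambda>x. a (c x) x) = M"
proof (rule measure_eqI)
  have T [measurable]: "(\<lambda>x. a (c x) x) \<in> measurable M M"
    by (rule measurable_compose_countable) simp_all
  fix A assume "A \<in> sets (distr M M (\<lambda>x. a (c x) x))"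
  then have A [measurable]: "A \<in> sets M" by simp
  define B where "B n = {y\<in>space M. c' y = n \<and> y \<in> A}" for n
  have B [measurable]: "B n \<in> sets M" for n
    unfolding B_def by measurable
  have "emeasure (distr M M (\<lambda>x. a (c x) x)) A
      = emeasure M ((\<lambda>x. a (c x) x) -` A \<inter> space M)"
    by (simp add: emeasure_distr)
  \<comment> \<open>The preimage is cut by the displacement \<open>n\<close>. On each piece the map
    is the measure-preserving \<open>a n\<close>, and by \<open>eq\<close> the images are disjoint
    too, lying in different level sets of \<open>c'\<close>.\<close>
  also have "(\<lambda>x. a (c x) x) -` A \<inter> space M = (\<Union>n. a n -` B n \<inter> space M)"
    using eq by (auto simp: B_def) (metis eq)+
  also have "emeasure M \<dots> = (\<integral>\<^sup>+n. emeasure M (a n -` B n \<inter> space M) \<partial>count_space UNIV)"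
  proof (rule emeasure_UN_countable)
    show "disjoint_family_on (\<lambda>n. a n -` B n \<inter> space M) UNIV"
      by (auto simp: disjoint_family_on_def B_def eq[symmetric])
  qed auto
  also have "\<dots> = (\<integral>\<^sup>+n. emeasure M (B n) \<partial>count_space UNIV)"
    by (simp add: emeasure_action_vimage)
  also have "\<dots> = emeasure M (\<Union>n. B n)"
    by (rule emeasure_UN_countable[symmetric]) (auto simp: disjoint_family_on_def B_def)
  also have "(\<Union>n. B n) = A"
    using sets.sets_into_space[OF A] by (auto simp: B_def)
  finally show "emeasure (distr M M (\<lambda>x. a (c x) x)) A = emeasure M A" .
qed simp

end

section \<open>The action of the integers generated by an automorphism\<close>

lemma int_action_int_iter:
  assumes "prob_space M" "S \<in> Aut M"
  shows "int_action M (int_iter M S)"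
proof -
  interpret prob_space M by fact
  let ?I = "the_inv_into (space M) S"
  note S = assms(2)[unfolded Aut_def, simplified]
  have [measurable]: "S \<in> measurable M M" "?I \<in> measurable M M"
    using S by auto
  have sp: "S x \<in> space M" "?I x \<in> space M" if "x \<in> space M" for x
    using that by (auto intro: measurable_space)
  have inv: "S (?I x) = x" "?I (S x) = x" if "x \<in> space M" for x
    using S that by (auto simp: bij_betw_def the_inv_into_f_f f_the_inv_into_f)
  have dI: "distr M M ?I = M"
  proof -
    have "distr M M ?I = distr (distr M M S) M ?I"
      using S by simp
    also have "\<dots> = distr M M (?I \<circ> S)"
      by (rule distr_distr) auto
    also have "\<dots> = distr M M (\<lambda>x. x)"
      by (rule distr_cong) (auto simp: inv)
    finally show ?thesis by simp
  qed
  have pow_meas [measurable]: "f ^^ n \<in> measurable M M" if "f \<in> measurable M M" for f :: "'a \<Rightarrow> 'a" and n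
    by (induction n) (auto simp: id_def intro: measurable_compose[OF _ that])
  have pow_distr: "distr M M (f ^^ n) = M" if "f \<in> measurable M M" "distr M M f = M"
    for f :: "'a \<Rightarrow> 'a" and n
  proof (induction n)
    case (Suc n)
    have "distr (distr M M (f ^^ n)) M f = distr M M (f \<circ> f ^^ n)"
      using that by (intro distr_distr) auto
    then show ?case
      unfolding Suc that(2) funpow.simps(2) ..
  qed (simp add: id_def)
  have step: "int_iter M S (1 + n) x = S (int_iter M S n x)"
    "int_iter M S n x \<in> space M" if x: "x \<in> space M" for n x
  proof -
    have b: "(?I ^^ k) x \<in> space M" for k
      using x by (induction k) (auto simp: sp)
    have f: "(S ^^ k) x \<in> space M" for k
      using x by (induction k) (auto simp: sp)
    show "int_iter M S n x \<in> space M"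
      using f b by (simp add: int_iter_def)
    show "int_iter M S (1 + n) x = S (int_iter M S n x)"
    proof (cases "0 \<le> n")
      case True
      then show ?thesis by (simp add: int_iter_def nat_add_distrib)
    next
      case False
      then have "nat (- n) = Suc (nat (- (1 + n)))" by simp
      then show ?thesis
        using False b[of "nat (- (1 + n))"]
        by (auto simp: int_iter_def inv)
    qed
  qed
  have step_back: "int_iter M S (n - 1) x = ?I (int_iter M S n x)" if x: "x \<in> space M" for n x
    using step[OF x, of "n - 1"] by (simp add: inv)
  show ?thesis
  proof
    fix n show "int_iter M S n \<in> measurable M M"
      by (simp add: int_iter_def)
    show "distr M M (int_iter M S n) = M"
      using S dI by (simp add: int_iter_def pow_distr)
  next
    fix x assume x: "x \<in> space M"
    show 0: "int_iter M S 0 x = x" by (simp add: int_iter_def)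
    fix m n
    show "int_iter M S (m + n) x = int_iter M S m (int_iter M S n x)"
    proof (induction m rule: int_induct[of _ 0])
      case base
      then show ?case by (simp add: int_iter_def)
    next
      case (step1 i)
      then show ?case
        using step(1)[OF x, of "i + n"] step(1)[OF step(2)[OF x], of i n]
        by (simp add: add.commute add.left_commute)
    next
      case (step2 i)
      then show ?case
        using step_back[OF x, of "i + n"] step_back[OF step(2)[OF x], of i n]
        by (simp add: algebra_simps)
    qed
  qed
qed

section \<open>Reordering the orbits over an odometer factor\<close>

text \<open>\<open>s k\<close> is a factor map onto the rotation by 1 of the integers modulo
  \<open>h k\<close>, and \<open>s_Suc\<close> makes these maps a tower. The identities hold at
  every point of the invariant conull set \<open>W\<close>, which avoids handling null sets level by
  level.\<close>

locale odometer_factor = int_action M a + block_lengths q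
  for M :: "'a measure" and a q +
  fixes s :: "nat \<Rightarrow> 'a \<Rightarrow> int" and W :: "'a set"
  assumes W_sets [measurable]: "W \<in> sets M"
    and AE_W: "AE x in M. x \<in> W"
    and action_W: "x \<in> W \<Longrightarrow> a n x \<in> W"
    and s_measurable [measurable]: "s k \<in> measurable M (count_space UNIV)"
    and s_range: "x \<in> W \<Longrightarrow> 0 \<le> s k x \<and> s k x < h k"
    and s_action: "x \<in> W \<Longrightarrow> s k (a n x) = (s k x + n) mod h k"
    and s_Suc: "x \<in> W \<Longrightarrow> s (Suc k) x mod h k = s k x"
begin

lemma W_space: "x \<in> W \<Longrightarrow> x \<in> space M"
  using sets.sets_into_space[OF W_sets] by auto

lemma pred_s [measurable]: "Measurable.pred M (\<lambda>x. Q (s k x))"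
  by (rule measurable_compose[OF s_measurable]) simp

lemma s_action_no_wrap:
  assumes "x \<in> W" "0 \<le> s k x + n" "s k x + n < h k"
  shows "s k (a n x) = s k x + n"
  using assms by (simp add: s_action)

subsection \<open>Equidistribution of the positions\<close>

text \<open>The measure-preserving map \<open>a i\<close> carries the points at position 0 onto
  those at position \<open>i\<close>.\<close>

lemma measure_s_eq:
  assumes "0 \<le> i" "i < h k"
  shows "measure M {x\<in>space M. x \<in> W \<and> s k x = i} = measure M {x\<in>space M. x \<in> W \<and> s k x = 0}"
    (is "measure M ?I = measure M ?O")
proof -
  have [measurable]: "?I \<in> sets M" "?O \<in> sets M" by measurable
  have "a (- i) -` ?O \<inter> space M = ?I"
  proof (intro set_eqI iffI)
    fix x assume x: "x \<in> a (- i) -` ?O \<inter> space M"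
    then have "a i (a (- i) x) = x" by (simp add: action_inverse)
    moreover have "a (- i) x \<in> W" "s k (a (- i) x) = 0" using x by auto
    ultimately show "x \<in> ?I"
      using assms x action_W[of "a (- i) x" i] s_action_no_wrap[of "a (- i) x" k i] by auto
  next
    fix x assume "x \<in> ?I"
    then show "x \<in> a (- i) -` ?O \<inter> space M"
      using action_W[of x "- i"] s_action_no_wrap[of x k "- i"] by auto
  qed
  then show ?thesis
    using emeasure_action_vimage[of ?O "- i"] by (simp add: measure_def)
qed

lemma measure_s_in:
  assumes "I \<subseteq> {0..<h k}"
  shows "measure M {x\<in>space M. x \<in> W \<and> s k x \<in> I} = card I / h k"
proof -
  let ?O = "measure M {x\<in>space M. x \<in> W \<and> s k x = 0}"
  have *: "measure M {x\<in>space M. x \<in> W \<and> s k x \<in> I} = card I * ?O"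
    if "I \<subseteq> {0..<h k}" for I
  proof -
    have fin: "finite I" using that finite_subset by blast
    have "{x\<in>space M. x \<in> W \<and> s k x \<in> I} = (\<Union>i\<in>I. {x\<in>space M. x \<in> W \<and> s k x = i})"
      by auto
    also have "measure M \<dots> = (\<Sum>i\<in>I. measure M {x\<in>space M. x \<in> W \<and> s k x = i})"
      using fin by (intro finite_measure_finite_Union) (auto simp: disjoint_family_on_def)
    also have "\<dots> = (\<Sum>i\<in>I. ?O)"
      using that by (intro sum.cong refl measure_s_eq) auto
    finally show ?thesis by simp
  qed
  \<comment> \<open>All \<open>h k\<close> positions together are conull, which fixes their common
    measure as \<open>1 / h k\<close>.\<close>
  have "measure M {x\<in>space M. x \<in> W \<and> s k x \<in> {0..<h k}} = 1"
    using AE_W s_range by (subst prob_eq_1) auto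
  then have "h k * ?O = 1"
    using *[of "{0..<h k}"] by simp
  then show ?thesis
    using *[OF assms] by (simp add: field_simps)
qed

subsection \<open>The reordered orbit relation\<close>

text \<open>Read \<open>related E x n m\<close> as \<open>S\<^sup>n x = T\<^sup>m x\<close>, where \<open>S\<close> generates the given action and \<open>T\<close> is
  the transformation moving the position \<open>perm E k (s k x)\<close> one step forward for every
  large \<open>k\<close>.\<close>

definition related :: "nat set \<Rightarrow> 'a \<Rightarrow> int \<Rightarrow> int \<Rightarrow> bool" where
  "related E x n m \<longleftrightarrow> (\<forall>\<^sub>F k in sequentially.
     0 \<le> s k x + n \<and> s k x + n < h k \<and> perm E k (s k x + n) = perm E k (s k x) + m)"

lemma related_measurable [measurable]: "Measurable.pred M (\<lambda>x. related E x n m)"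
  unfolding related_def eventually_sequentially by measurable

lemma related_unique_right:
  assumes "related E x n m" "related E x n m'"
  shows "m = m'"
proof -
  have "\<forall>\<^sub>F k in sequentially. m = m'"
    using assms unfolding related_def by eventually_elim simp
  then show ?thesis by simp
qed

lemma related_unique_left:
  assumes "related E x n m" "related E x n' m"
  shows "n = n'"
proof -
  have "\<forall>\<^sub>F k in sequentially. n = n'"
    using assms unfolding related_def
  proof eventually_elim
    case (elim k)
    then show ?case
      using perm_inj[of "s k x + n" k "s k x + n'" E] by auto
  qed
  then show ?thesis by simp
qed

lemma related_0: "x \<in> W \<Longrightarrow> related E x 0 0"
  unfolding related_def using s_range by (intro always_eventually) simp

lemma related_trans:
  assumes x: "x \<in> W" and "related E x n m" "related E (a n x) n' m'"
  shows "related E x (n + n') (m + m')"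
  using assms(2,3) unfolding related_def
proof eventually_elim
  case (elim k)
  then have "s k (a n x) = s k x + n"
    using x by (intro s_action_no_wrap) auto
  then show ?case
    using elim by (simp add: add.assoc)
qed

lemma related_inverse:
  assumes x: "x \<in> W" and "related E x n m"
  shows "related E (a n x) (- n) (- m)"
  using assms(2) unfolding related_def
proof eventually_elim
  case (elim k)
  then have "s k (a n x) = s k x + n"
    using x by (intro s_action_no_wrap) auto
  then show ?case
    using elim s_range[OF x, of k] by simp
qed

text \<open>Once both points lie in a common block of level \<open>k\<close>, their digits from
  \<open>k\<close> on agree, so by \<open>perm_block\<close> the difference of the shuffled
  positions stays \<open>m\<close> at all higher levels.\<close>

lemma relatedI:
  assumes x: "x \<in> W" and k: "0 \<le> s k x + n" "s k x + n < h k"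
    "perm E k (s k x + n) = perm E k (s k x) + m"
  shows "related E x n m"
  unfolding related_def eventually_sequentially
proof (intro exI allI impI)
  fix l assume "k \<le> l"
  then show "0 \<le> s l x + n \<and> s l x + n < h l \<and> perm E l (s l x + n) = perm E l (s l x) + m"
  proof (induction l rule: dec_induct)
    case (step l)
    define j where "j = s (Suc l) x div h l"
    have sl: "s (Suc l) x = s l x + h l * j"
      using s_Suc[OF x, of l] mod_mult_div_eq[of "s (Suc l) x" "h l"] by (simp add: j_def)
    have j: "0 \<le> j \<and> j < q l"
      unfolding j_def using s_range[OF x] by (intro div_h_range) auto
    have "s (Suc l) x + n = (s l x + n) + h l * j"
      by (simp add: sl)
    then show ?case
      using step.IH j s_range[OF x, of l] block_range[of "s l x + n" l j]
      unfolding sl by (simp only: perm_block) simp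
  qed (use k in auto)
qed

text \<open>Room to move \<open>m\<close> steps either way inside one block, in the original and in
  the shuffled order; this makes \<open>related\<close> total in each of its arguments.\<close>

definition interior :: "nat set \<Rightarrow> 'a \<Rightarrow> bool" where
  "interior E x \<longleftrightarrow> (\<forall>m::nat. \<exists>k. int m \<le> s k x \<and> s k x + int m < h k \<and>
     int m \<le> perm E k (s k x) \<and> perm E k (s k x) + int m < h k)"

text \<open>Quantifying over the whole orbit makes this set invariant, so that orbits are reordered
  either entirely or not at all.\<close>

definition good :: "nat set \<Rightarrow> 'a set" where
  "good E = {x\<in>space M. x \<in> W \<and> (\<forall>n. interior E (a n x))}"

lemma interior_measurable [measurable]: "Measurable.pred M (interior E)"
  unfolding interior_def[abs_def] by measurable

lemma good_sets [measurable]: "good E \<in> sets M"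
  unfolding good_def by measurable

lemma good_W: "x \<in> good E \<Longrightarrow> x \<in> W"
  by (simp add: good_def)

lemma action_good: "x \<in> good E \<Longrightarrow> a n x \<in> good E"
  using action_add[of x _ n] unfolding good_def by (auto simp: action_W) (metis)

lemma action_good_iff: "x \<in> space M \<Longrightarrow> a n x \<in> good E \<longleftrightarrow> x \<in> good E"
  using action_good[of x E n] action_good[of "a n x" E "- n"] by (auto simp: action_inverse)

text \<open>A bad position at level \<open>k\<close> is within \<open>m\<close> of an end of the
  block or is sent there by the involution \<open>perm E k\<close>. These are at most
  \<open>4 * m\<close> of the \<open>h k\<close> equidistributed positions, so being bad at all
  levels has measure 0.\<close>

lemma AE_interior: "AE x in M. interior E x"
  unfolding interior_def AE_all_countable
proof
  fix m :: nat
  define ok where "ok k i \<longleftrightarrow> int m \<le> i \<and> i + int m < h k \<and>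
    int m \<le> perm E k i \<and> perm E k i + int m < h k" for k i
  define N where "N = {x\<in>space M. x \<in> W \<and> (\<forall>k. \<not> ok k (s k x))}"
  have [measurable]: "N \<in> sets M"
    unfolding N_def by measurable
  have le: "measure M N \<le> 4 * real m / real k" if "0 < k" for k
  proof -
    define I where "I = {i\<in>{0..<h k}. \<not> ok k i}"
    define J where "J = {0..<int m} \<union> {h k - int m..<h k}"
    have "I \<subseteq> J \<union> perm E k ` J"
    proof
      fix i assume i: "i \<in> I"
      then have "i = perm E k (perm E k i)" "0 \<le> perm E k i \<and> perm E k i < h k"
        using perm_involutive perm_range by (auto simp: I_def)
      then show "i \<in> J \<union> perm E k ` J"
        using i by (auto simp: I_def J_def ok_def)
    qed
    then have "card I \<le> card (J \<union> perm E k ` J)"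
      by (intro card_mono) (auto simp: J_def)
    also have "\<dots> \<le> card J + card J"
      by (intro order_trans[OF card_Un_le] add_mono card_image_le order_refl) (auto simp: J_def)
    also have "\<dots> \<le> 4 * m"
      using card_Un_le[of "{0..<int m}" "{h k - int m..<h k}"] by (simp add: J_def)
    finally have card: "card I \<le> 4 * m" .
    have "measure M N \<le> measure M {x\<in>space M. x \<in> W \<and> s k x \<in> I}"
      by (intro finite_measure_mono) (use s_range in \<open>auto simp: N_def I_def\<close>)
    also have "\<dots> = card I / h k"
      by (rule measure_s_in) (auto simp: I_def)
    also have "\<dots> \<le> (4 * real m) / real k"
    proof (rule frac_le)
      show "real (card I) \<le> 4 * real m" using card by simp
      show "real k \<le> real_of_int (h k)" using h_gt[of k] by linarith
    qed (use that in auto)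
    finally show ?thesis .
  qed
  have "(\<lambda>k. 4 * real m / real k) \<longlonglongrightarrow> 0"
    by (rule lim_const_over_n)
  then have "measure M N \<le> 0"
    by (rule LIMSEQ_le_const) (use le in \<open>auto intro!: exI[of _ 1]\<close>)
  then have "measure M N = 0"
    by (simp add: measure_le_0_iff)
  then have "AE x in M. x \<notin> N"
    by (intro AE_not_in) (simp add: emeasure_eq_measure null_setsI)
  with AE_W show "AE x in M. \<exists>k. int m \<le> s k x \<and> s k x + int m < h k \<and>
     int m \<le> perm E k (s k x) \<and> perm E k (s k x) + int m < h k"
    using AE_space by eventually_elim (auto simp: N_def ok_def)
qed

lemma AE_good: "AE x in M. x \<in> good E"
proof -
  have "AE x in M. \<forall>n. interior E (a n x)"
    unfolding AE_all_countable by (intro allI AE_action AE_interior)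
  with AE_W AE_space show ?thesis
    by eventually_elim (simp add: good_def)
qed

lemma good_interior: "x \<in> good E \<Longrightarrow> interior E x"
  using action_0[of x] unfolding good_def by (metis (mono_tags, lifting) mem_Collect_eq)

lemma related_total_right:
  assumes x: "x \<in> good E"
  shows "\<exists>m. related E x n m"
proof -
  obtain k where "int (nat \<bar>n\<bar>) \<le> s k x" "s k x + int (nat \<bar>n\<bar>) < h k"
    using good_interior[OF x] unfolding interior_def by blast
  then have "related E x n (perm E k (s k x + n) - perm E k (s k x))"
    by (intro relatedI[of x k] good_W[OF x]) auto
  then show ?thesis ..
qed

lemma related_total_left:
  assumes x: "x \<in> good E"
  shows "\<exists>n. related E x n m"
proof -
  obtain k where "int (nat \<bar>m\<bar>) \<le> perm E k (s k x)" "perm E k (s k x) + int (nat \<bar>m\<bar>) < h k"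
    using good_interior[OF x] unfolding interior_def by blast
  then have m: "0 \<le> perm E k (s k x) + m" "perm E k (s k x) + m < h k"
    by auto
  \<comment> \<open>As \<open>perm E k\<close> is an involution, it turns the shifted shuffled
    position back into the original position of the point reached.\<close>
  have "related E x (perm E k (perm E k (s k x) + m) - s k x) m"
    using perm_range[OF m] perm_involutive[OF m] by (intro relatedI[of _ k] good_W[OF x]) auto
  then show ?thesis ..
qed

subsection \<open>The transformation with reordered orbits\<close>

text \<open>With \<open>T = reordered E 1\<close>, \<open>disp\<close> gives the power of
  \<open>S\<close> that equals \<open>T^m\<close> at \<open>x\<close>, and \<open>time\<close> the
  power of \<open>T\<close> that equals \<open>S^n\<close>; the exponent 1 yields the two orbit
  cocycles. The default 0 makes \<open>T\<close> the identity outside \<open>good E\<close>.\<close>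

definition disp :: "nat set \<Rightarrow> int \<Rightarrow> 'a \<Rightarrow> int" where
  "disp E m x = (THE n. if x \<in> good E then related E x n m else n = 0)"

definition time :: "nat set \<Rightarrow> int \<Rightarrow> 'a \<Rightarrow> int" where
  "time E n x = (THE m. if x \<in> good E then related E x n m else m = 0)"

lemma disp_eq_iff: "x \<in> good E \<Longrightarrow> disp E m x = n \<longleftrightarrow> related E x n m"
  using related_total_left[of x E m] unfolding disp_def
  by (auto intro: the_equality related_unique_left intro!: theI2[where Q = "\<lambda>n. related E x n m"])

lemma disp_not_good: "x \<notin> good E \<Longrightarrow> disp E m x = 0"
  by (simp add: disp_def)

lemma time_eq_iff: "x \<in> good E \<Longrightarrow> time E n x = m \<longleftrightarrow> related E x n m"
  using related_total_right[of x E n] unfolding time_def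
  by (auto intro: the_equality related_unique_right intro!: theI2[where Q = "\<lambda>m. related E x n m"])

lemma disp_measurable [measurable]: "disp E m \<in> measurable M (count_space UNIV)"
  unfolding disp_def[abs_def]
  by (rule measurable_THE[where I = UNIV])
    (auto intro: related_unique_left split: if_splits)

lemma time_measurable [measurable]: "time E m \<in> measurable M (count_space UNIV)"
  unfolding time_def[abs_def]
  by (rule measurable_THE[where I = UNIV])
    (auto intro: related_unique_right split: if_splits)

definition reordered :: "nat set \<Rightarrow> int \<Rightarrow> 'a \<Rightarrow> 'a" where
  "reordered E m x = a (disp E m x) x"

lemma reordered_eq: "x \<in> good E \<Longrightarrow> related E x n m \<Longrightarrow> reordered E m x = a n x"
  using disp_eq_iff[of x E m n] by (simp add: reordered_def)

lemma reordered_not_good: "x \<in> space M \<Longrightarrow> x \<notin> good E \<Longrightarrow> reordered E m x = x"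
  by (simp add: reordered_def disp_not_good action_0)

lemma reordered_action: "int_action M (reordered E)"
proof
  fix n
  show "reordered E n \<in> measurable M M"
    unfolding reordered_def by (rule measurable_compose_countable) simp_all
  show "distr M M (reordered E n) = M"
    unfolding reordered_def
  proof (rule distr_displacement)
    \<comment> \<open>If \<open>y = T^n x\<close>, then \<open>x = T^(-n) y\<close>, so the
      displacement of \<open>x\<close> is minus the one that \<open>T^(-n)\<close> has at
      \<open>y\<close>.\<close>
    show "(\<lambda>x. - disp E (- n) x) \<in> measurable M (count_space UNIV)"
      by (rule measurable_compose[OF disp_measurable]) simp
    fix x m assume x: "x \<in> space M"
    show "disp E n x = m \<longleftrightarrow> - disp E (- n) (a m x) = m"
    proof (cases "x \<in> good E")
      case True
      then have "- disp E (- n) (a m x) = m \<longleftrightarrow> related E (a m x) (- m) (- n)"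
        using disp_eq_iff[OF action_good, of x E "- n" m "- m"] by auto
      also have "\<dots> \<longleftrightarrow> related E x m n"
        using related_inverse[of x E m n] related_inverse[of "a m x" E "- m" "- n"] x
        by (auto simp: action_inverse good_W[OF True] action_W)
      finally show ?thesis
        using disp_eq_iff[OF True] by simp
    qed (use x in \<open>auto simp: disp_not_good action_good_iff\<close>)
  qed simp
next
  fix x assume x: "x \<in> space M"
  show "reordered E 0 x = x"
    using x reordered_eq[OF _ related_0] reordered_not_good[of x E 0]
    by (cases "x \<in> good E") (auto simp: good_W action_0)
  fix m n
  show "reordered E (m + n) x = reordered E m (reordered E n x)"
  proof (cases "x \<in> good E")
    case True
    obtain i where i: "related E x i n"
      using related_total_left[OF True] by blast
    have g: "a i x \<in> good E" by (rule action_good[OF True])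
    obtain j where j: "related E (a i x) j m"
      using related_total_left[OF g] by blast
    have "related E x (j + i) (m + n)"
      using related_trans[OF good_W[OF True] i j] by (simp add: add.commute)
    then show ?thesis
      using reordered_eq[OF True] reordered_eq[OF g j] i x by (simp add: action_add)
  qed (simp add: x reordered_not_good)
qed

subsection \<open>Orbit equivalence with the original action\<close>

lemma int_iter_reordered:
  "x \<in> space M \<Longrightarrow> int_iter M (reordered E 1) n x = reordered E n x"
  by (rule int_action.int_iter_action[OF reordered_action])

lemma reordered_Aut: "reordered E n \<in> Aut M"
  by (rule int_action.action_Aut[OF reordered_action])

lemma action_eq_reordered: "x \<in> good E \<Longrightarrow> a n x = reordered E (time E n x) x"
  using reordered_eq[of x E n "time E n x"] time_eq_iff[of x E n "time E n x"] by simp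

lemma orbit_equivalence_reordered:
  "orbit_equivalence M (a 1) M (reordered E 1) (\<lambda>x. x) (\<lambda>x. x) (time E 1) (disp E 1)"
proof -
  have "AE x in M. a 1 x = int_iter M (reordered E 1) (time E 1 x) x"
    using AE_good[of E] AE_space
    by eventually_elim (simp add: int_iter_reordered action_eq_reordered)
  moreover have "AE x in M. reordered E 1 x = int_iter M (a 1) (disp E 1 x) x"
    using AE_space by eventually_elim (simp add: reordered_def int_iter_action)
  ultimately show ?thesis
    by (simp add: orbit_equivalence_def measure_iso_def)
qed

lemma ergodic_reordered:
  assumes "ergodic M (a 1)"
  shows "ergodic M (reordered E 1)"
  unfolding ergodic_def
proof (intro ballI impI)
  fix A assume A [measurable]: "A \<in> sets M" and inv: "reordered E 1 -` A \<inter> space M = A"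
  interpret T: int_action M "reordered E" by (rule reordered_action)
  have step: "reordered E 1 x \<in> A \<longleftrightarrow> x \<in> A" if "x \<in> space M" for x
    using inv that by auto
  have all: "reordered E n x \<in> A \<longleftrightarrow> x \<in> A" if x: "x \<in> space M" for n x
  proof (induction n rule: int_induct[of _ 0])
    case (step1 i)
    then show ?case
      using step[of "reordered E i x"] T.action_add[OF x, of 1 i] x by (simp add: add.commute)
  next
    case (step2 i)
    then show ?case
      using step[of "reordered E (i - 1) x"] T.action_add[OF x, of 1 "i - 1"] x by simp
  qed (simp add: T.action_0 x)
  \<comment> \<open>On good points a step of \<open>S\<close> is a power of \<open>T\<close>.
    Intersecting with the invariant set \<open>good E\<close> gives the strict invariance that
    \<open>ergodic\<close> asks for.\<close>
  have "a 1 x \<in> A \<longleftrightarrow> x \<in> A" if "x \<in> good E" for x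
    unfolding action_eq_reordered[OF that] by (rule all) (rule W_space[OF good_W[OF that]])
  then have "a 1 -` (A \<inter> good E) \<inter> space M = A \<inter> good E"
    using sets.sets_into_space[OF A] by (auto simp: action_good_iff)
  then have "measure M (A \<inter> good E) = 0 \<or> measure M (A \<inter> good E) = 1"
    using assms unfolding ergodic_def by simp
  moreover have "measure M (A \<inter> good E) = measure M A"
    using AE_good[of E] by (intro finite_measure_eq_AE) auto
  ultimately show "measure M A = 0 \<or> measure M A = 1" by simp
qed

text \<open>A period of \<open>x\<close> is divisible by every \<open>h k\<close>, while the modulus
  at level \<open>\<bar>n\<bar>\<close> exceeds \<open>\<bar>n\<bar>\<close>.\<close>

lemma action_free:
  assumes x: "x \<in> W" and "a n x = x"
  shows "n = 0"
proof -
  let ?k = "nat \<bar>n\<bar>"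
  have "(s ?k x + n) mod h ?k = s ?k x mod h ?k"
    using s_action[OF x, of ?k n] s_range[OF x, of ?k] assms(2) by simp
  then have "h ?k dvd n"
    by (simp add: mod_eq_dvd_iff)
  moreover have "\<bar>n\<bar> < h ?k"
    using h_gt[of ?k] by simp
  ultimately show ?thesis
    using zdvd_imp_le[of "h ?k" "\<bar>n\<bar>"] by fastforce
qed

lemma free_action: "free M (a 1)"
proof -
  have "AE x in M. \<forall>k::int. k \<noteq> 0 \<longrightarrow> int_iter M (a 1) k x \<noteq> x"
    using AE_W AE_space by eventually_elim (auto simp: int_iter_action dest: action_free)
  then show ?thesis by (simp add: free_def)
qed

lemma free_reordered: "free M (reordered E 1)"
proof -
  have "AE x in M. \<forall>k::int. k \<noteq> 0 \<longrightarrow> int_iter M (reordered E 1) k x \<noteq> x"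
    using AE_good[of E] AE_space
  proof eventually_elim
    case (elim x)
    have "k = 0" if "reordered E k x = x" for k
    proof -
      have "disp E k x = 0"
        using that elim by (intro action_free[of x]) (auto simp: good_W reordered_def)
      then show ?thesis
        using elim disp_eq_iff[of x E k 0] related_unique_right[of E x 0 k 0] related_0[of x E]
        by (auto simp: good_W)
    qed
    then show ?case
      using elim by (auto simp: int_iter_reordered)
  qed
  then show ?thesis by (simp add: free_def)
qed

subsection \<open>Integrability of the cocycles\<close>

lemma first_non_last:
  assumes x: "x \<in> good E"
  shows "\<exists>k. s k x = h k - 1 \<and> s (Suc k) x + 1 < h (Suc k)"
    and "\<exists>k. perm E k (s k x) = h k - 1 \<and> perm E (Suc k) (s (Suc k) x) + 1 < h (Suc k)"
proof -
  have *: "\<exists>k. u k = h k - 1 \<and> u (Suc k) + 1 < h (Suc k)"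
    if u: "\<And>k. 0 \<le> u k \<and> u k < h k" "\<exists>k. u k + 1 < h k" for u
  proof -
    \<comment> \<open>The least such level is positive: since \<open>h 0 = 1\<close>, the only place
      at level 0 is the last one. By minimality the preceding level then has \<open>u\<close> at its
      last place.\<close>
    obtain k where k: "u k + 1 < h k" "\<And>l. l < k \<Longrightarrow> \<not> u l + 1 < h l"
      using exists_least_iff[THEN iffD1, OF u(2)] by blast
    then obtain l where l: "k = Suc l"
      using u(1)[of 0] by (cases k) auto
    then have "\<not> u l + 1 < h l" using k by auto
    then show ?thesis
      using k(1) u(1)[of l] unfolding l by (intro exI[of _ l]) auto
  qed
  obtain k where "s k x + int 1 < h k" "perm E k (s k x) + int 1 < h k"
    using good_interior[OF x] unfolding interior_def by blast
  then have k: "s k x + 1 < h k" "perm E k (s k x) + 1 < h k"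
    by auto
  show "\<exists>k. s k x = h k - 1 \<and> s (Suc k) x + 1 < h (Suc k)"
    using s_range[OF good_W[OF x]] k by (intro *[of "\<lambda>k. s k x"]) auto
  show "\<exists>k. perm E k (s k x) = h k - 1 \<and> perm E (Suc k) (s (Suc k) x) + 1 < h (Suc k)"
    using s_range[OF good_W[OF x]] perm_range k
    by (intro *[of "\<lambda>k. perm E k (s k x)"]) auto
qed

text \<open>The step of \<open>S\<close> leaves a block of level \<open>k\<close> but stays in the
  block of level \<open>Suc k\<close>, so \<open>perm_step_le\<close> bounds the change of the
  shuffled position.\<close>

lemma time_bound:
  assumes x: "x \<in> good E"
  shows "\<exists>k. s k x = h k - 1 \<and> \<bar>time E 1 x\<bar> \<le> 4 * h k"
proof -
  obtain k where k: "s k x = h k - 1" "s (Suc k) x + 1 < h (Suc k)"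
    using first_non_last[OF x] by blast
  let ?m = "perm E (Suc k) (s (Suc k) x + 1) - perm E (Suc k) (s (Suc k) x)"
  have "related E x 1 ?m"
    using k s_range[OF good_W[OF x], of "Suc k"] by (intro relatedI[of x "Suc k"] good_W[OF x]) auto
  then have "time E 1 x = ?m"
    using x by (simp add: time_eq_iff)
  moreover have "\<bar>?m\<bar> \<le> 4 * h k"
    using s_Suc[OF good_W[OF x], of k] k by (intro perm_step_le) simp
  ultimately show ?thesis
    using k by auto
qed

text \<open>The mirror image of \<open>time_bound\<close>: the step is now taken from the shuffled
  position \<open>t\<close>, and as \<open>perm\<close> is its own inverse the same estimate bounds
  the change of the original position.\<close>

lemma disp_bound:
  assumes x: "x \<in> good E"
  shows "\<exists>k. s k x = perm E k (h k - 1) \<and> \<bar>disp E 1 x\<bar> \<le> 4 * h k"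
proof -
  note r = s_range[OF good_W[OF x]]
  obtain k where k: "perm E k (s k x) = h k - 1"
    "perm E (Suc k) (s (Suc k) x) + 1 < h (Suc k)"
    using first_non_last[OF x] by blast
  define t where "t = perm E (Suc k) (s (Suc k) x)"
  have t: "0 \<le> t" "t + 1 < h (Suc k)" "perm E (Suc k) t = s (Suc k) x"
    unfolding t_def using k(2) perm_range perm_involutive r by blast+
  have "t mod h k = perm E k (s k x) mod h k"
    using s_Suc[OF good_W[OF x], of k] by (simp add: t_def)
  also have "\<dots> = h k - 1"
    using perm_range[of "s k x" k E] r[of k] k(1) by (metis mod_pos_pos_trivial)
  finally have tmod: "t mod h k = h k - 1" .
  let ?n = "perm E (Suc k) (t + 1) - perm E (Suc k) t"
  have "related E x ?n 1"
    using t perm_range[of "t + 1" "Suc k" E] perm_involutive[of "t + 1" "Suc k" E]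
    by (intro relatedI[of x "Suc k"] good_W[OF x]) (auto simp del: perm.simps simp: t_def[symmetric])
  then have "disp E 1 x = ?n"
    using x by (simp add: disp_eq_iff)
  moreover have "\<bar>?n\<bar> \<le> 4 * h k"
    by (rule perm_step_le[OF tmod])
  moreover have "s k x = perm E k (h k - 1)"
    using perm_involutive[of "s k x" k E] r[of k] k(1) by simp
  ultimately show ?thesis
    by auto
qed

text \<open>Every point is charged to a level \<open>k\<close> at which it sits at the single
  position \<open>i k\<close>, an event of probability \<open>1 / h k\<close>; the integral is thus
  dominated by the sum of \<open>b k / h k\<close>.\<close>

lemma nn_integral_cocycle_finite:
  fixes \<omega> :: "real \<Rightarrow> real" and b :: "nat \<Rightarrow> real" and c :: "'a \<Rightarrow> int"
  assumes i: "\<And>k. 0 \<le> i k \<and> i k < h k"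
    and bound: "\<And>x. x \<in> good E \<Longrightarrow> \<exists>k. s k x = i k \<and> \<bar>c x\<bar> \<le> 4 * h k"
    and b: "\<And>k n::int. \<bar>n\<bar> \<le> 4 * h k \<Longrightarrow> \<omega> (real_of_int \<bar>n\<bar>) \<le> b k"
    and b_nonneg: "\<And>k. 0 \<le> b k"
    and b_summable: "summable (\<lambda>k. b k / h k)"
  shows "(\<integral>\<^sup>+x. ennreal (\<omega> (real_of_int \<bar>c x\<bar>)) \<partial>M) < \<infinity>"
proof -
  define B where "B k = {x\<in>space M. x \<in> W \<and> s k x \<in> {i k}}" for k
  have [measurable]: "B k \<in> sets M" for k
    unfolding B_def by measurable
  have "AE x in M. ennreal (\<omega> (real_of_int \<bar>c x\<bar>)) \<le> (\<Sum>k. ennreal (b k) * indicator (B k) x)"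
    using AE_good[of E] AE_space
  proof eventually_elim
    case (elim x)
    obtain k where k: "s k x = i k" "\<bar>c x\<bar> \<le> 4 * h k"
      using bound elim by blast
    define f where "f l = ennreal (b l) * indicator (B l) x" for l
    have "ennreal (\<omega> (real_of_int \<bar>c x\<bar>)) \<le> f k"
      using k elim b[of "c x" k] by (simp add: f_def B_def good_W ennreal_leI)
    also have "\<dots> = sum f {k}"
      by simp
    also have "\<dots> \<le> (\<Sum>l. f l)"
      by (intro sum_le_suminf) auto
    also have "\<dots> = (\<Sum>l. ennreal (b l) * indicator (B l) x)"
      by (simp add: f_def)
    finally show ?case .
  qed
  then have "(\<integral>\<^sup>+x. ennreal (\<omega> (real_of_int \<bar>c x\<bar>)) \<partial>M)
      \<le> (\<integral>\<^sup>+x. (\<Sum>k. ennreal (b k) * indicator (B k) x) \<partial>M)"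
    by (rule nn_integral_mono_AE)
  also have "\<dots> = (\<Sum>k. \<integral>\<^sup>+x. ennreal (b k) * indicator (B k) x \<partial>M)"
    by (rule nn_integral_suminf) measurable
  also have "\<dots> = (\<Sum>k. ennreal (b k / h k))"
  proof (rule suminf_cong)
    fix k
    have "measure M (B k) = 1 / h k"
      unfolding B_def using i[of k] by (subst measure_s_in) auto
    then show "(\<integral>\<^sup>+x. ennreal (b k) * indicator (B k) x \<partial>M) = ennreal (b k / h k)"
      using b_nonneg[of k] by (simp add: nn_integral_cmult_indicator emeasure_eq_measure ennreal_mult'[symmetric])
  qed
  also have "\<dots> < \<infinity>"
    using b_nonneg b_summable by (simp add: suminf_ennreal2 less_top[symmetric])
  finally show ?thesis .
qed

lemma integrably_orbit_equivalent_reordered: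
  assumes "ergodic M (a 1)"
    and b: "\<And>k n::int. \<bar>n\<bar> \<le> 4 * h k \<Longrightarrow> \<omega> (real_of_int \<bar>n\<bar>) \<le> b k"
    and b_nonneg: "\<And>k. 0 \<le> b k"
    and b_summable: "summable (\<lambda>k. b k / h k)"
  shows "integrably_orbit_equivalent \<omega> M (a 1) M (reordered E 1)"
proof -
  have "(\<integral>\<^sup>+x. ennreal (\<omega> (real_of_int \<bar>time E 1 x\<bar>)) \<partial>M) < \<infinity>"
    using b b_nonneg b_summable
    by (intro nn_integral_cocycle_finite[where i = "\<lambda>k. h k - 1" and b = b and E = E])
      (auto simp: int_one_le_iff_zero_less time_bound)
  moreover have "(\<integral>\<^sup>+x. ennreal (\<omega> (real_of_int \<bar>disp E 1 x\<bar>)) \<partial>M) < \<infinity>"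
    using b b_nonneg b_summable perm_range[of "h k - 1" k E for k]
    by (intro nn_integral_cocycle_finite[where i = "\<lambda>k. perm E k (h k - 1)" and b = b and E = E])
      (auto simp: int_one_le_iff_zero_less disp_bound)
  ultimately show ?thesis
    unfolding integrably_orbit_equivalent_def
    using action_Aut free_action assms(1) reordered_Aut free_reordered ergodic_reordered
      orbit_equivalence_reordered by blast
qed

subsection \<open>Alternating sets\<close>

text \<open>Each step of \<open>T\<close> toggles membership, so \<open>T^m\<close> toggles it
  \<open>m\<close> times, and \<open>related\<close> rewrites \<open>T^m x\<close> as
  \<open>S^n x\<close>.\<close>

lemma alternating_parity:
  assumes "A \<in> sets M" "AE x in M. reordered E 1 x \<in> A \<longleftrightarrow> x \<notin> A"
  shows "AE x in M. \<forall>n m. related E x n m \<longrightarrow> (a n x \<in> A \<longleftrightarrow> (x \<in> A \<longleftrightarrow> even m))"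
proof -
  interpret T: int_action M "reordered E" by (rule reordered_action)
  have "AE x in M. \<forall>m. reordered E 1 (reordered E m x) \<in> A \<longleftrightarrow> reordered E m x \<notin> A"
    unfolding AE_all_countable by (intro allI T.AE_action assms)
  with AE_good[of E] AE_space show ?thesis
  proof eventually_elim
    case (elim x)
    then have x: "x \<in> space M"
      and step: "reordered E (1 + m) x \<in> A \<longleftrightarrow> reordered E m x \<notin> A" for m
      by (auto simp: T.action_add)
    have "reordered E m x \<in> A \<longleftrightarrow> (x \<in> A \<longleftrightarrow> even m)" for m
    proof (induction m rule: int_induct[of _ 0])
      case (step1 i)
      then show ?case using step[of i] by (simp add: add.commute)
    next
      case (step2 i)
      then show ?case using step[of "i - 1"] by auto
    qed (simp add: T.action_0 x)
    then show ?case
      using elim by (metis reordered_eq)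
  qed
qed

text \<open>At a level \<open>k\<close> in exactly one of \<open>E\<close> and \<open>F\<close>, a
  shift by \<open>S^n\<close> out of the swapped zone takes times of different parity under the two
  reorderings. So exactly one of the memberships in \<open>A\<close> and \<open>B\<close> changes,
  and the symmetric difference is toggled on a set of measure at least 2/7.\<close>

lemma alternating_sets_far:
  assumes "E \<noteq> F" and [measurable]: "A \<in> sets M" "B \<in> sets M"
    and A: "AE x in M. reordered E 1 x \<in> A \<longleftrightarrow> x \<notin> A"
    and B: "AE x in M. reordered F 1 x \<in> B \<longleftrightarrow> x \<notin> B"
  shows "1 / 7 \<le> measure M ((A - B) \<union> (B - A))"
proof -
  obtain k where k: "k \<in> E \<longleftrightarrow> k \<notin> F"
    using assms(1) by blast
  \<comment> \<open>The swapped zone consists of the digits below \<open>c\<close>; a shift by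
    \<open>n\<close> carries it onto the unswapped digits from \<open>c\<close> to
    \<open>2 * c - 1\<close>.\<close>
  define c where "c = 2 * (q k div 4)"
  define n where "n = h k * c"
  define D where "D = (A - B) \<union> (B - A)"
  define Y where "Y = {x\<in>space M. x \<in> W \<and> s (Suc k) x \<in> {0..<n}}"
  have [measurable]: "D \<in> sets M" "Y \<in> sets M"
    unfolding D_def Y_def by measurable
  have c: "0 \<le> c" "2 * c \<le> q k" "2 * q k \<le> 7 * c"
    using q_ge[of k] unfolding c_def by presburger+
  have n: "0 \<le> n" "n \<le> h (Suc k)"
    using c q_ge[of k] unfolding n_def h_Suc by (auto intro!: mult_left_mono)
  have flip: "AE x in M. x \<in> Y \<longrightarrow> (a n x \<in> D \<longleftrightarrow> x \<notin> D)"
    using alternating_parity[OF _ A] alternating_parity[OF _ B]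
  proof (rule AE_mp[OF _ AE_mp[OF _ AE_I2]], goal_cases)
    case (3 x)
    show ?case
    proof (intro impI)
      assume pA: "\<forall>n m. related E x n m \<longrightarrow> (a n x \<in> A \<longleftrightarrow> (x \<in> A \<longleftrightarrow> even m))"
        and pB: "\<forall>n m. related F x n m \<longrightarrow> (a n x \<in> B \<longleftrightarrow> (x \<in> B \<longleftrightarrow> even m))"
        and x: "x \<in> Y"
      then have xW: "x \<in> W" by (simp add: Y_def)
      define i j where "i = s (Suc k) x mod h k" and "j = s (Suc k) x div h k"
      have s: "s (Suc k) x = i + h k * j" by (simp add: i_def j_def)
      have i: "0 \<le> i" "i < h k" by (simp_all add: i_def)
      have j: "0 \<le> j" "j < q k"
        using div_h_range s_range[OF xW] by (auto simp: j_def)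
      have "s (Suc k) x < h k * c"
        using x by (simp add: Y_def n_def)
      then have "h k * j < h k * c"
        using i unfolding s by linarith
      then have jc: "j < c" by (simp add: mult_less_cancel_left_pos)
      have rel: "related G x n (h k * (shuffle G k (j + c) - shuffle G k j))" for G
      proof (rule relatedI[OF xW, of "Suc k"])
        have e: "s (Suc k) x + n = i + h k * (j + c)"
          by (simp add: s n_def algebra_simps)
        show "0 \<le> s (Suc k) x + n" "s (Suc k) x + n < h (Suc k)"
          unfolding e using block_range[of i k "j + c"] i j jc c by auto
        show "perm G (Suc k) (s (Suc k) x + n)
            = perm G (Suc k) (s (Suc k) x) + h k * (shuffle G k (j + c) - shuffle G k j)"
          unfolding e unfolding s perm_block[OF i] by (simp add: algebra_simps)
      qed
      \<comment> \<open>The two shuffles have different parity at \<open>j\<close> and equal parity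
        at \<open>j + c\<close>. As \<open>h k\<close> is odd, the two travel times in
        \<open>rel\<close> differ in parity.\<close>
      have "even (shuffle E k j + shuffle F k j) \<longleftrightarrow> \<not> j < c"
        "even (shuffle E k (j + c) + shuffle F k (j + c)) \<longleftrightarrow> \<not> j + c < c"
        unfolding c_def using j c by (intro even_shuffle_eq_iff k; simp add: c_def)+
      then show "a n x \<in> D \<longleftrightarrow> x \<notin> D"
        using pA[rule_format, OF rel] pB[rule_format, OF rel] jc j odd_h[of k]
        unfolding D_def by auto
    qed
  qed auto
  have "2 / 7 \<le> c / q k"
    using c q_ge[of k] by (simp add: field_simps)
  also have "c / q k = n / h (Suc k)"
    by (simp add: n_def h_Suc)
  also have "\<dots> = measure M Y"
    unfolding Y_def using n by (subst measure_s_in) auto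
  \<comment> \<open>For almost every \<open>x\<close> in \<open>Y\<close>, one of \<open>x\<close>
    and \<open>S^n x\<close> lies in \<open>D\<close>.\<close>
  also have "\<dots> \<le> measure M (D \<union> (a n -` D \<inter> space M))"
    using flip by (intro finite_measure_mono_AE) (auto simp: Y_def)
  also have "\<dots> \<le> measure M D + measure M (a n -` D \<inter> space M)"
    by (rule measure_Un_le) auto
  also have "measure M (a n -` D \<inter> space M) = measure M D"
    by (simp add: measure_def emeasure_action_vimage)
  finally show ?thesis
    by (simp add: D_def)
qed

end

section \<open>Separability of the measure algebra\<close>

text \<open>Finite stages exhausting the algebra generated by a base; each stage is visibly
  countable.\<close>

primrec algebra_stage :: "'a set \<Rightarrow> 'a set set \<Rightarrow> nat \<Rightarrow> 'a set set" where
  "algebra_stage \<Omega> \<B> 0 = insert {} \<B>"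
| "algebra_stage \<Omega> \<B> (Suc n) =
     (\<lambda>(A, B). A \<union> B) ` (algebra_stage \<Omega> \<B> n \<times> algebra_stage \<Omega> \<B> n) \<union> (-) \<Omega> ` algebra_stage \<Omega> \<B> n"

lemma countable_algebra_stage: "countable \<B> \<Longrightarrow> countable (algebra_stage \<Omega> \<B> n)"
  by (induction n) auto

lemma algebra_stage_Suc: "algebra_stage \<Omega> \<B> n \<subseteq> algebra_stage \<Omega> \<B> (Suc n)"
proof
  fix A assume "A \<in> algebra_stage \<Omega> \<B> n"
  then have "(case (A, A) of (A, B) \<Rightarrow> A \<union> B) \<in> algebra_stage \<Omega> \<B> (Suc n)"
    unfolding algebra_stage.simps by blast
  then show "A \<in> algebra_stage \<Omega> \<B> (Suc n)" by simp
qed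

lemma algebra_stage_mono: "m \<le> n \<Longrightarrow> algebra_stage \<Omega> \<B> m \<subseteq> algebra_stage \<Omega> \<B> n"
  by (rule lift_Suc_mono_le[of "algebra_stage \<Omega> \<B>", OF algebra_stage_Suc])

lemma (in finite_measure) measure_sym_diff_triangle:
  assumes "A \<in> sets M" "B \<in> sets M" "C \<in> sets M"
  shows "measure M (sym_diff A C) \<le> measure M (sym_diff A B) + measure M (sym_diff B C)"
proof -
  have "measure M (sym_diff A C) \<le> measure M (sym_diff A B \<union> sym_diff B C)"
    using assms by (intro finite_measure_mono) auto
  also have "\<dots> \<le> measure M (sym_diff A B) + measure M (sym_diff B C)"
    using assms by (intro measure_Un_le) auto
  finally show ?thesis .
qed

text \<open>The algebra generated by a countable base is countable, and the sets it approximates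
  form a sigma-algebra containing the open sets.\<close>

lemma (in finite_measure) countable_dense_family:
  assumes "standard_borel M"
  shows "\<exists>\<D>. countable \<D> \<and> \<D> \<subseteq> sets M \<and>
    (\<forall>A\<in>sets M. \<forall>e>0. \<exists>B\<in>\<D>. measure M (sym_diff A B) < e)"
proof -
  obtain X where X: "second_countable X" "topspace X = space M"
    "sets M = sigma_sets (space M) {U. openin X U}"
    using assms unfolding standard_borel_def by blast
  obtain \<B> where \<B>: "countable \<B>" "\<And>V. V \<in> \<B> \<Longrightarrow> openin X V"
    "\<And>U x. openin X U \<Longrightarrow> x \<in> U \<Longrightarrow> \<exists>V\<in>\<B>. x \<in> V \<and> V \<subseteq> U"
    using X(1) unfolding second_countable_def by metis
  define \<D> where "\<D> = (\<Union>n. algebra_stage (space M) \<B> n)"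
  have open_sets: "U \<in> sets M" if "openin X U" for U
    using that unfolding X(3) by (intro sigma_sets.Basic) simp
  have "algebra_stage (space M) \<B> n \<subseteq> sets M" for n
    using \<B>(2) open_sets by (induction n) auto
  then have \<D>_sets: "\<D> \<subseteq> sets M"
    unfolding \<D>_def by blast
  have \<D>_countable: "countable \<D>"
    unfolding \<D>_def using \<B>(1) by (simp add: countable_algebra_stage)
  have \<B>_\<D>: "V \<in> \<D>" if "V \<in> insert {} \<B>" for V
    unfolding \<D>_def using that by (intro UN_I[of 0]) auto
  have \<D>_compl: "space M - A \<in> \<D>" if "A \<in> \<D>" for A
  proof -
    obtain n where "A \<in> algebra_stage (space M) \<B> n"
      using \<open>A \<in> \<D>\<close> unfolding \<D>_def by blast
    then have "space M - A \<in> algebra_stage (space M) \<B> (Suc n)" by simp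
    then show ?thesis unfolding \<D>_def by blast
  qed
  have \<D>_Un: "A \<union> B \<in> \<D>" if AB: "A \<in> \<D>" "B \<in> \<D>" for A B
  proof -
    obtain m n where "A \<in> algebra_stage (space M) \<B> m" "B \<in> algebra_stage (space M) \<B> n"
      using AB unfolding \<D>_def by blast
    then have "A \<in> algebra_stage (space M) \<B> (max m n)" "B \<in> algebra_stage (space M) \<B> (max m n)"
      using algebra_stage_mono[OF max.cobounded1] algebra_stage_mono[OF max.cobounded2] by blast+
    then have "(case (A, B) of (A, B) \<Rightarrow> A \<union> B) \<in> algebra_stage (space M) \<B> (Suc (max m n))"
      unfolding algebra_stage.simps by blast
    then show ?thesis unfolding \<D>_def prod.case by blast
  qed
  define approx where "approx A \<longleftrightarrow> A \<in> sets M \<and> (\<forall>e>0. \<exists>B\<in>\<D>. measure M (sym_diff A B) < e)" for A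
  have approx_\<D>: "approx A" if "A \<in> \<D>" for A
    unfolding approx_def using that \<D>_sets by (auto intro!: bexI[of _ A])
  have approx_Un: "approx (A \<union> A')" if "approx A" "approx A'" for A A'
    unfolding approx_def
  proof (intro conjI allI impI)
    have [measurable]: "A \<in> sets M" "A' \<in> sets M"
      using that by (auto simp: approx_def)
    show "A \<union> A' \<in> sets M" by simp
    fix e :: real assume "0 < e"
    then have "0 < e / 2" by simp
    with that[unfolded approx_def] obtain B B' where B: "B \<in> \<D>" "measure M (sym_diff A B) < e / 2"
      and B': "B' \<in> \<D>" "measure M (sym_diff A' B') < e / 2"
      by blast
    have [measurable]: "B \<in> sets M" "B' \<in> sets M"
      using B B' \<D>_sets by auto
    have "measure M (sym_diff (A \<union> A') (B \<union> B')) \<le> measure M (sym_diff A B \<union> sym_diff A' B')"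
      by (intro finite_measure_mono) auto
    also have "\<dots> \<le> measure M (sym_diff A B) + measure M (sym_diff A' B')"
      by (intro measure_Un_le) auto
    also have "\<dots> < e" using B B' by linarith
    finally show "\<exists>B\<in>\<D>. measure M (sym_diff (A \<union> A') B) < e"
      using \<D>_Un[OF B(1) B'(1)] by blast
  qed
  have approx_UN: "approx (\<Union>i. A i)" if A: "\<And>i. approx (A i)" for A :: "nat \<Rightarrow> 'a set"
    unfolding approx_def
  proof (intro conjI allI impI)
    have As [measurable]: "A i \<in> sets M" for i
      using A by (auto simp: approx_def)
    show "(\<Union>i. A i) \<in> sets M" by measurable
    fix e :: real assume e: "0 < e"
    \<comment> \<open>Partial unions exhaust the union up to \<open>e / 2\<close> in measure, and
      each is itself approximable up to \<open>e / 2\<close>.\<close>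
    define C where "C n = (\<Union>i\<le>n. A i)" for n
    have C: "approx (C n)" for n
      unfolding C_def by (induction n) (auto simp: atMost_Suc Un_commute intro!: A approx_Un)
    have [measurable]: "C n \<in> sets M" for n
      unfolding C_def by measurable
    have "(\<lambda>n. measure M (C n)) \<longlonglongrightarrow> measure M (\<Union>n. C n)"
      by (rule finite_Lim_measure_incseq) (force simp: C_def incseq_def)+
    moreover have "(\<Union>n. C n) = (\<Union>i. A i)"
      unfolding C_def by blast
    ultimately have "\<forall>\<^sub>F n in sequentially. measure M (\<Union>i. A i) - e / 2 < measure M (C n)"
      using e by (intro order_tendstoD(1)) auto
    then obtain n where n: "measure M (\<Union>i. A i) - e / 2 < measure M (C n)"
      by (auto simp: eventually_sequentially)
    have sub: "C n \<subseteq> (\<Union>i. A i)"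
      by (auto simp: C_def)
    then have "measure M (sym_diff (\<Union>i. A i) (C n)) = measure M (\<Union>i. A i) - measure M (C n)"
      by (subst finite_measure_Diff[symmetric]) (auto intro!: arg_cong[where f = "measure M"])
    moreover obtain B where B: "B \<in> \<D>" "measure M (sym_diff (C n) B) < e / 2"
      using C[of n] e unfolding approx_def by (meson half_gt_zero)
    ultimately have "measure M (sym_diff (\<Union>i. A i) B) < e"
      using measure_sym_diff_triangle[of "\<Union>i. A i" "C n" B] n \<D>_sets by fastforce
    then show "\<exists>B\<in>\<D>. measure M (sym_diff (\<Union>i. A i) B) < e"
      using B(1) by blast
  qed
  have "approx A" if "A \<in> sigma_sets (space M) {U. openin X U}" for A
    using that
  proof induction
    case (Basic U)
    \<comment> \<open>The added \<open>{}\<close> keeps the family nonempty, so that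
      \<open>from_nat_into\<close> enumerates it.\<close>
    define \<V> where "\<V> = insert {} {V \<in> \<B>. V \<subseteq> U}"
    have "U = \<Union>\<V>"
      using \<B>(3)[of U] Basic unfolding \<V>_def by blast
    moreover have "range (from_nat_into \<V>) = \<V>"
      using \<B>(1) by (intro range_from_nat_into) (auto simp: \<V>_def)
    moreover have "approx (from_nat_into \<V> i)" for i
      using from_nat_into[of \<V> i] by (intro approx_\<D> \<B>_\<D>) (auto simp: \<V>_def)
    ultimately show ?case
      using approx_UN by metis
  next
    case Empty
    show ?case by (intro approx_\<D> \<B>_\<D>) simp
  next
    case (Compl A)
    then have A: "A \<in> sets M" by (simp add: X(3))
    show ?case
      unfolding approx_def
    proof (intro conjI allI impI)
      show "space M - A \<in> sets M" using A by simp
      fix e :: real assume "0 < e"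
      then obtain B where B: "B \<in> \<D>" "measure M (sym_diff A B) < e"
        using Compl.IH unfolding approx_def by blast
      have "sym_diff (space M - A) (space M - B) = sym_diff A B"
        using sets.sets_into_space[OF A] sets.sets_into_space[of B] B(1) \<D>_sets by blast
      then show "\<exists>B\<in>\<D>. measure M (sym_diff (space M - A) B) < e"
        using B \<D>_compl by metis
    qed
  next
    case (Union A)
    then show ?case by (intro approx_UN)
  qed
  then show ?thesis
    using \<D>_countable \<D>_sets unfolding approx_def X(3)[symmetric] by blast
qed

text \<open>Approximating each \<open>A E\<close> within \<open>e / 2\<close> would inject the power
  set of the naturals into a countable dense family.\<close>

lemma no_separated_powerset_family:
  assumes "finite_measure M" "standard_borel M"
    and "0 < e" and A: "\<And>E :: nat set. A E \<in> sets M"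
    and far: "\<And>E F. E \<noteq> F \<Longrightarrow> e \<le> measure M (sym_diff (A E) (A F))"
  shows False
proof -
  interpret finite_measure M by fact
  obtain \<D> where \<D>: "countable \<D>" "\<D> \<subseteq> sets M"
    "\<And>A e. A \<in> sets M \<Longrightarrow> 0 < e \<Longrightarrow> \<exists>B\<in>\<D>. measure M (sym_diff A B) < e"
    using countable_dense_family[OF assms(2)] by blast
  have "\<forall>E. \<exists>B\<in>\<D>. measure M (sym_diff (A E) B) < e / 2"
    using \<D>(3)[OF A, of "e / 2"] \<open>0 < e\<close> by auto
  then obtain B where B: "\<And>E. B E \<in> \<D>" "\<And>E. measure M (sym_diff (A E) (B E)) < e / 2"
    by metis
  have "inj B"
  proof (rule injI, rule ccontr)
    fix E F assume eq: "B E = B F" and "E \<noteq> F"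
    then have "e \<le> measure M (sym_diff (A E) (A F))" using far by blast
    also have "\<dots> \<le> measure M (sym_diff (A E) (B E)) + measure M (sym_diff (B E) (A F))"
      using A B(1) \<D>(2) by (intro measure_sym_diff_triangle) auto
    also have "\<dots> < e"
      using B(2)[of E] B(2)[of F] unfolding eq Un_commute[of "B F - A F"] by linarith
    finally show False by simp
  qed
  moreover have "countable (range B)"
    using B(1) by (intro countable_subset[OF _ \<D>(1)]) auto
  ultimately have "countable (UNIV :: nat set set)"
    using countable_image_inj_on by blast
  then have "range (from_nat_into (UNIV :: nat set set)) = Pow UNIV"
    by (simp add: range_from_nat_into)
  then show False
    using Cantors_theorem by blast
qed

section \<open>Odometer factors from non-ergodic powers\<close>

context int_action
begin

definition cyclic_coloring :: "nat \<Rightarrow> 'a set \<Rightarrow> ('a \<Rightarrow> int) \<Rightarrow> bool" where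
  "cyclic_coloring p W c \<longleftrightarrow> W \<in> sets M \<and> (AE x in M. x \<in> W) \<and> (\<forall>x\<in>W. \<forall>n. a n x \<in> W) \<and>
    c \<in> measurable M (count_space UNIV) \<and> (\<forall>x\<in>W. 0 \<le> c x \<and> c x < int p) \<and>
    (\<forall>x\<in>W. \<forall>n. c (a n x) = (c x + n) mod int p)"

text \<open>Color \<open>x\<close> by its return times to a set of points whose orbit visits an \<open>S\<^sup>p\<close>-invariant
  set at a prescribed set of times modulo \<open>p\<close>.  As \<open>p\<close> is prime, a nontrivial set of residues
  has no translational symmetry, so these return times form one residue class.\<close>

lemma cyclic_coloring_exists:
  assumes erg: "ergodic M (a 1)" and p: "prime p" and nerg: "\<not> ergodic M (a (int p))"
  shows "\<exists>W c. cyclic_coloring p W c"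
proof -
  have p0: "0 < int p" using p prime_gt_0_nat by simp
  obtain A where A [measurable]: "A \<in> sets M" and inv: "a (int p) -` A \<inter> space M = A"
    and nontriv: "measure M A \<noteq> 0" "measure M A \<noteq> 1"
    using nerg unfolding ergodic_def by blast
  have step: "a (int p) x \<in> A \<longleftrightarrow> x \<in> A" if "x \<in> space M" for x
    using inv that by auto
  have mult: "a (int p * l) x \<in> A \<longleftrightarrow> x \<in> A" if x: "x \<in> space M" for l x
  proof (induction l rule: int_induct[of _ 0])
    case (step1 i)
    then show ?case
      using step[of "a (int p * i) x"] action_add[OF x, of "int p" "int p * i"] x
      by (simp add: algebra_simps)
  next
    case (step2 i)
    then show ?case
      using step[of "a (int p * (i - 1)) x"] action_add[OF x, of "int p" "int p * (i - 1)"] x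
      by (simp add: algebra_simps)
  qed (simp add: action_0 x)
  have mod: "a (n mod int p) x \<in> A \<longleftrightarrow> a n x \<in> A" if x: "x \<in> space M" for n x
    using mult[of "a (n mod int p) x" "n div int p"] x
    by (simp add: action_add[symmetric])
  \<comment> \<open>The residues at which the orbit visits \<open>A\<close>; by invariance of
    \<open>A\<close> under \<open>S^p\<close> they describe all visits.\<close>
  define N where "N x = {i\<in>{0..<int p}. a i x \<in> A}" for x
  have N_iff: "n mod int p \<in> N x \<longleftrightarrow> a n x \<in> A" if "x \<in> space M" for n x
    using mod[OF that] p0 by (simp add: N_def)
  define B where "B F = {x\<in>space M. N x = F}" for F
  have B_sets [measurable]: "B F \<in> sets M" if "F \<subseteq> {0..<int p}" for F
  proof -
    have "B F = {x\<in>space M. \<forall>i\<in>{0..<int p}. a i x \<in> A \<longleftrightarrow> i \<in> F}"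
      using that unfolding B_def N_def by blast
    also have "\<dots> \<in> sets M" by measurable
    finally show ?thesis .
  qed
  have "\<exists>F. F \<subseteq> {0..<int p} \<and> F \<noteq> {} \<and> F \<noteq> {0..<int p} \<and> measure M (B F) \<noteq> 0"
  proof (rule ccontr)
    \<comment> \<open>If almost every \<open>N x\<close> were empty or full, \<open>A\<close> would
      agree almost everywhere with the \<open>S\<close>-invariant set \<open>B {0..<int p}\<close>,
      against ergodicity.\<close>
    assume none: "\<not> ?thesis"
    define G where "G = Pow {0..<int p} - {{}, {0..<int p}}"
    have "AE x in M. \<forall>F\<in>G. x \<notin> B F"
    proof (rule AE_finite_allI)
      fix F assume "F \<in> G"
      then have "B F \<in> null_sets M"
        using none by (intro null_setsI) (auto simp: G_def emeasure_eq_measure)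
      then show "AE x in M. x \<notin> B F" by (rule AE_not_in)
    qed (simp add: G_def)
    with AE_space have triv: "AE x in M. N x = {} \<or> N x = {0..<int p}"
    proof eventually_elim
      case (elim x)
      then have "N x \<notin> G" by (auto simp: B_def)
      moreover have "N x \<subseteq> {0..<int p}" by (auto simp: N_def)
      ultimately show ?case by (simp add: G_def)
    qed
    let ?A = "B {0..<int p}"
    have full: "x \<in> ?A \<longleftrightarrow> (\<forall>n. a n x \<in> A)" if x: "x \<in> space M" for x
    proof
      assume "x \<in> ?A"
      then show "\<forall>n. a n x \<in> A"
        using N_iff[OF x] p0 by (auto simp: B_def)
    qed (use x in \<open>auto simp: B_def N_def\<close>)
    have "a 1 x \<in> ?A \<longleftrightarrow> x \<in> ?A" if x: "x \<in> space M" for x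
    proof -
      have "(\<forall>n. a n (a 1 x) \<in> A) \<longleftrightarrow> (\<forall>n. a n x \<in> A)"
        using x action_add[OF x, of _ 1] by (metis diff_add_cancel)
      then show ?thesis using full x by simp
    qed
    then have "a 1 -` ?A \<inter> space M = ?A"
      by (auto simp: B_def)
    then have "measure M ?A = 0 \<or> measure M ?A = 1"
      using erg unfolding ergodic_def by auto
    moreover have "measure M ?A = measure M A"
    proof (rule finite_measure_eq_AE)
      show "AE x in M. x \<in> ?A \<longleftrightarrow> x \<in> A"
        using triv AE_space
      proof eventually_elim
        case (elim x)
        have "0 \<in> N x \<longleftrightarrow> x \<in> A"
          using N_iff[of x 0] elim by (simp add: action_0)
        moreover have "N x = {0..<int p} \<longleftrightarrow> 0 \<in> N x"
          using elim(1) p0 by force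
        ultimately show ?case
          using elim(2) by (simp add: B_def)
      qed
    qed auto
    ultimately show False using nontriv by simp
  qed
  then obtain F where F: "F \<subseteq> {0..<int p}" "F \<noteq> {}" "F \<noteq> {0..<int p}" "measure M (B F) \<noteq> 0"
    by blast
  have B_return: "a n x \<in> B F \<longleftrightarrow> int p dvd n" if xB: "x \<in> B F" for n x
  proof
    have x: "x \<in> space M" using xB by (simp add: B_def)
    assume "int p dvd n"
    then obtain l where l: "n = int p * l" by (rule dvdE)
    have "a i (a n x) \<in> A \<longleftrightarrow> a i x \<in> A" for i
      using mult[of "a i x" l] x by (simp add: l action_add[symmetric] add.commute)
    then show "a n x \<in> B F" using xB by (simp add: B_def N_def)
  next
    have x: "x \<in> space M" using xB by (simp add: B_def)
    assume "a n x \<in> B F"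
    then have *: "a (i + n) x \<in> A \<longleftrightarrow> a i x \<in> A" for i
      using xB N_iff[OF x, of i] N_iff[of "a n x" i] x by (simp add: B_def action_add)
    have mult_n: "a (i + l * n) x \<in> A \<longleftrightarrow> a i x \<in> A" for i l
    proof (induction l rule: int_induct[of _ 0])
      case (step1 j)
      then show ?case using *[of "i + j * n"] by (simp add: algebra_simps)
    next
      case (step2 j)
      then show ?case using *[of "i + (j - 1) * n"] by (simp add: algebra_simps)
    qed simp
    show "int p dvd n"
    proof (rule ccontr)
      assume "\<not> int p dvd n"
      then have "coprime (int p) n"
        using p prime_imp_coprime[of "int p" n] by simp
      then obtain u v where uv: "u * int p + v * n = 1"
        using bezout_int[of "int p" n] by auto
      \<comment> \<open>The visits are symmetric under shifts by \<open>p\<close> and by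
        \<open>n\<close>, hence by the Bezout identity under every shift, so \<open>N x\<close> is
        trivial.\<close>
      have "a i x \<in> A \<longleftrightarrow> x \<in> A" for i
      proof -
        have "i = int p * (u * i) + (v * i) * n"
          using uv by (metis distrib_left mult.assoc mult.commute mult.right_neutral)
        then have "a i x \<in> A \<longleftrightarrow> a (int p * (u * i)) x \<in> A"
          using mult_n[of "int p * (u * i)" "v * i"] by simp
        then show ?thesis using mult[OF x] by simp
      qed
      then have "N x = {} \<or> N x = {0..<int p}"
        unfolding N_def by auto
      then show False
        using F xB by (auto simp: B_def)
    qed
  qed
  \<comment> \<open>The union of the orbits meeting \<open>B F\<close> is invariant and not null,
    hence conull by ergodicity.\<close>
  define W where "W = {x\<in>space M. \<exists>e. a e x \<in> B F}"
  have W_eq: "W = (\<Union>e. a e -` B F \<inter> space M)"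
    by (auto simp: W_def)
  have W_sets [measurable]: "W \<in> sets M"
    unfolding W_eq using B_sets[OF F(1)] by auto
  have W_inv: "a n x \<in> W \<longleftrightarrow> x \<in> W" if x: "x \<in> space M" for n x
  proof -
    have "(\<exists>e. a e (a n x) \<in> B F) \<longleftrightarrow> (\<exists>e. a e x \<in> B F)"
      using x action_add[OF x, of _ n] by (metis diff_add_cancel)
    then show ?thesis using x by (simp add: W_def)
  qed
  have "a 1 -` W \<inter> space M = W"
    using W_inv by (auto simp: W_def)
  then have "measure M W = 0 \<or> measure M W = 1"
    using erg unfolding ergodic_def by simp
  moreover have "measure M (B F) \<le> measure M W"
  proof (rule finite_measure_mono[OF _ W_sets])
    show "B F \<subseteq> W"
      by (auto simp: W_def B_def action_0 intro!: exI[of _ 0])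
  qed
  ultimately have "measure M W = 1"
    using F(4) measure_nonneg[of M "B F"] by linarith
  then have AE_W: "AE x in M. x \<in> W"
    using prob_eq_1[of W] by simp
  \<comment> \<open>Color \<open>r\<close> means having left \<open>B F\<close> exactly
    \<open>r\<close> steps ago, so the action advances colors.\<close>
  define color where "color x r \<longleftrightarrow> 0 \<le> r \<and> r < int p \<and> a (- r) x \<in> B F" for x r
  have color_ex: "\<exists>r. color x r" if xW: "x \<in> W" for x
  proof -
    obtain e where e: "x \<in> space M" "a e x \<in> B F"
      using xW by (auto simp: W_def)
    let ?r = "(- e) mod int p"
    have "a (- ?r - e) (a e x) \<in> B F"
      unfolding B_return[OF e(2)] by (metis dvd_minus_mod dvd_minus_iff minus_diff_eq diff_minus_eq_add minus_diff_commute)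
    then have "a (- ?r) x \<in> B F"
      using e(1) by (simp add: action_add[symmetric])
    then show ?thesis using p0 by (intro exI[of _ ?r]) (simp add: color_def)
  qed
  have color_unique: "r = r'" if "x \<in> space M" "color x r" "color x r'" for x r r'
  proof -
    have "a (r - r') (a (- r) x) \<in> B F"
      using that by (simp add: color_def action_add[symmetric])
    then have "int p dvd r - r'"
      using B_return that by (simp add: color_def)
    then have "r mod int p = r' mod int p"
      by (simp add: mod_eq_dvd_iff)
    then show ?thesis using that by (simp add: color_def)
  qed
  define c where "c x = (THE r. if x \<in> W then color x r else r = 0)" for x
  have "c \<in> measurable M (count_space UNIV)"
    unfolding c_def
  proof (rule measurable_THE[where I = UNIV])
    show "Measurable.pred M (\<lambda>x. if x \<in> W then color x r else r = 0)" for r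
      unfolding color_def using F(1) by measurable
  qed (auto split: if_splits intro: color_unique)
  moreover have c_eq: "c x = r" if "x \<in> W" "color x r" for x r
    unfolding c_def using that color_unique[of x] by (auto simp: W_def intro!: the_equality)
  moreover have c_color: "color x (c x)" if "x \<in> W" for x
    using color_ex[OF that] c_eq[OF that] by blast
  moreover have "c (a n x) = (c x + n) mod int p" if x: "x \<in> W" for x n
  proof (rule c_eq)
    have xs: "x \<in> space M" using x by (simp add: W_def)
    show "a n x \<in> W" using W_inv x xs by simp
    let ?r = "(c x + n) mod int p"
    have "int p dvd n - ?r + c x"
      using dvd_minus_mod[of "int p" "c x + n"] by (simp add: algebra_simps)
    then have "a (n - ?r + c x) (a (- c x) x) \<in> B F"
      using c_color[OF x] B_return by (simp add: color_def)
    then have "a (- ?r) (a n x) \<in> B F"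
      using xs by (simp add: action_add[symmetric])
    then show "color (a n x) ?r" using p0 by (simp add: color_def)
  qed
  ultimately show ?thesis
    using AE_W W_inv W_sets unfolding color_def cyclic_coloring_def
    by (intro exI[of _ W] exI[of _ c]) (auto simp: W_def)
qed

end

section \<open>Gluing cyclic factors by the Chinese remainder theorem\<close>

lemma crt_unique:
  fixes m q :: int
  assumes "coprime m q" "0 < m" "0 < q" "0 \<le> u" "u < m" "0 \<le> v" "v < q"
  shows "\<exists>!i. 0 \<le> i \<and> i < m * q \<and> i mod m = u \<and> i mod q = v"
proof (rule ex_ex1I)
  obtain z w where zw: "z * m + w * q = 1"
    using bezout_int[of m q] assms(1) by auto
  define y where "y = u * (w * q) + v * (z * m)"
  have "y = u * (z * m + w * q) + m * (z * (v - u))" "y = v * (z * m + w * q) + q * (w * (u - v))"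
    by (simp_all add: y_def algebra_simps)
  then have "y = u + m * (z * (v - u))" "y = v + q * (w * (u - v))"
    by (simp_all add: zw)
  then have "y mod m = u" "y mod q = v"
    using assms by (metis mod_mult_self2 mod_pos_pos_trivial)+
  then have "y mod (m * q) mod m = u" "y mod (m * q) mod q = v"
    by (simp_all add: mod_mod_cancel)
  moreover have "0 \<le> y mod (m * q) \<and> y mod (m * q) < m * q"
    using assms by simp
  ultimately show "\<exists>i. 0 \<le> i \<and> i < m * q \<and> i mod m = u \<and> i mod q = v" by blast
next
  fix i j assume i: "0 \<le> i \<and> i < m * q \<and> i mod m = u \<and> i mod q = v"
    and j: "0 \<le> j \<and> j < m * q \<and> j mod m = u \<and> j mod q = v"
  then have "m dvd i - j" "q dvd i - j" by (simp_all add: mod_eq_dvd_iff[symmetric])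
  then have "m * q dvd i - j"
    using assms(1) by (intro divides_mult)
  then have "i mod (m * q) = j mod (m * q)" by (simp add: mod_eq_dvd_iff)
  then show "i = j" using i j by simp
qed

lemma (in int_action) odometer_factor_exists:
  assumes coloring: "\<And>p. prime p \<Longrightarrow> \<exists>W c. cyclic_coloring p W c"
  shows "\<exists>q s W. odometer_factor M a q s W \<and> (\<forall>k. R k \<le> q k)"
proof -
  obtain V c where "\<And>p. prime p \<Longrightarrow> cyclic_coloring p (V p) (c p)"
    using coloring by metis
  then have V: "\<And>p. prime p \<Longrightarrow> V p \<in> sets M" "\<And>p. prime p \<Longrightarrow> AE x in M. x \<in> V p"
      "\<And>p x n. prime p \<Longrightarrow> x \<in> V p \<Longrightarrow> a n x \<in> V p"
    and c: "\<And>p. prime p \<Longrightarrow> c p \<in> measurable M (count_space UNIV)"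
      "\<And>p x. prime p \<Longrightarrow> x \<in> V p \<Longrightarrow> 0 \<le> c p x \<and> c p x < int p"
      "\<And>p x n. prime p \<Longrightarrow> x \<in> V p \<Longrightarrow> c p (a n x) = (c p x + n) mod int p"
    unfolding cyclic_coloring_def by simp_all
  \<comment> \<open>Exceeding the current modulus \<open>m\<close> makes the new prime coprime to
    it, exceeding 5 makes it odd and large enough for \<open>block_lengths\<close>, and exceeding
    \<open>R k\<close> gives the growth.\<close>
  define pick where "pick k m = (SOME p::nat. prime p \<and> max m (max 5 (R k)) < int p)" for k m
  have pick: "prime (pick k m) \<and> max m (max 5 (R k)) < int (pick k m)" for k m
    unfolding pick_def
  proof (rule someI_ex)
    obtain p where "prime p" "nat (max m (max 5 (R k))) < p"
      using bigger_prime by blast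
    then show "\<exists>p. prime p \<and> max m (max 5 (R k)) < int p"
      by (intro exI[of _ p]) auto
  qed
  define H where "H = rec_nat 1 (\<lambda>k m. m * int (pick k m))"
  have H_0: "H 0 = 1" and H_Suc: "H (Suc k) = H k * int (pick k (H k))" for k
    by (simp_all add: H_def)
  define p where "p k = pick k (H k)" for k
  have p: "prime (p k)" "H k < int (p k)" "5 < int (p k)" "R k < int (p k)" for k
    using pick[of k "H k"] by (auto simp: p_def)
  define q where "q k = int (p k)" for k
  have "odd (q k)" for k
    using p(1,3)[of k] prime_odd_nat[of "p k"] by (simp add: q_def)
  then interpret block_lengths q
    using p(3) by unfold_locales (simp_all add: q_def less_imp_le)
  have "H (Suc k) = H k * q k" for k
    by (simp add: H_Suc q_def p_def)
  then have h_H: "h k = H k" for k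
    by (induction k) (simp_all add: h_Suc H_0)
  have cop: "coprime (h k) (q k)" for k
  proof -
    have "\<not> q k dvd h k"
      using p(2)[of k] zdvd_imp_le[of "q k" "h k"] by (auto simp: h_H[symmetric] q_def)
    moreover have "prime (q k)"
      using p(1) by (simp add: q_def)
    ultimately show ?thesis
      using prime_imp_coprime[of "q k" "h k"] by (simp add: coprime_commute)
  qed
  \<comment> \<open>The description is total, so \<open>s\<close> can be built by recursion on the
    whole space; \<open>crt_unique\<close> gives it meaning on \<open>W\<close>.\<close>
  define crt where "crt k u v = (THE i. 0 \<le> i \<and> i < h k * q k \<and> i mod h k = u \<and> i mod q k = v)" for k u v
  define s where "s = rec_nat (\<lambda>x. 0) (\<lambda>k t x. crt k (t x) (c (p k) x))"
  have s_0: "s 0 x = 0" and s_Suc: "s (Suc k) x = crt k (s k x) (c (p k) x)" for k x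
    by (simp_all add: s_def)
  define W where "W = (\<Inter>k. V (p k))"
  have WV: "x \<in> V (p k)" if "x \<in> W" for x k
    using that by (simp add: W_def)
  have crt: "0 \<le> s (Suc k) x \<and> s (Suc k) x < h k * q k \<and> s (Suc k) x mod h k = s k x \<and>
      s (Suc k) x mod q k = c (p k) x"
    if "0 \<le> s k x \<and> s k x < h k" "x \<in> W" for k x
  proof -
    have "0 < q k" "0 \<le> c (p k) x \<and> c (p k) x < q k"
      using c(2)[OF p(1) WV[OF that(2)], of k] unfolding q_def by linarith+
    then show ?thesis
      unfolding s_Suc crt_def
      using that(1) by (intro theI'[OF crt_unique[OF cop h_pos]]) blast+
  qed
  have range: "0 \<le> s k x \<and> s k x < h k" if "x \<in> W" for k x
    using that by (induction k) (use crt in \<open>auto simp: s_0 h_Suc\<close>)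
  have W_inv: "a n x \<in> W" if "x \<in> W" for n x
    using that V(3) p(1) by (auto simp: W_def)
  have "odometer_factor M a q s W"
  proof unfold_locales
    show "W \<in> sets M"
      unfolding W_def using V(1) p(1) by (intro sets.countable_INT) auto
    show "AE x in M. x \<in> W"
      unfolding W_def using V(2) p(1) by (simp add: AE_all_countable)
    show "s k \<in> measurable M (count_space UNIV)" for k
    proof (induction k)
      case (Suc k)
      have "(\<lambda>x. (\<lambda>u x. crt k u (c (p k) x)) (s k x) x) \<in> measurable M (count_space UNIV)"
      proof (rule measurable_compose_countable[OF _ Suc])
        show "(\<lambda>x. crt k u (c (p k) x)) \<in> measurable M (count_space UNIV)" for u
          by (rule measurable_compose[OF c(1)[OF p(1)]]) simp
      qed
      then show ?case
        by (simp add: s_Suc[abs_def])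
    qed (simp add: s_0[abs_def])
    fix x k assume x: "x \<in> W"
    show "s (Suc k) x mod h k = s k x"
      using crt[OF range[OF x] x] by simp
    show "0 \<le> s k x \<and> s k x < h k" by (rule range[OF x])
    fix n
    show "s k (a n x) = (s k x + n) mod h k"
    proof (induction k)
      case (Suc k)
      let ?y = "a n x"
      have y: "?y \<in> W" by (rule W_inv[OF x])
      have "s (Suc k) ?y mod h k = (s (Suc k) x + n) mod h k"
        using crt[OF range[OF y] y, of k] crt[OF range[OF x] x, of k] Suc.IH
        by (metis mod_add_left_eq)
      moreover have "s (Suc k) ?y mod q k = (s (Suc k) x + n) mod q k"
        using crt[OF range[OF y] y, of k] crt[OF range[OF x] x, of k]
          c(3)[OF p(1) WV[OF x], of k n] unfolding q_def
        by (metis mod_add_left_eq)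
      ultimately have "h (Suc k) dvd s (Suc k) ?y - (s (Suc k) x + n)"
        unfolding h_Suc using cop by (intro divides_mult) (simp_all add: mod_eq_dvd_iff)
      then have "s (Suc k) ?y mod h (Suc k) = (s (Suc k) x + n) mod h (Suc k)"
        by (simp add: mod_eq_dvd_iff)
      then show ?case
        using range[OF y, of "Suc k"] by simp
    qed (simp add: s_0)
  qed (use W_inv in auto)
  then show ?thesis
    using p(4) by (intro exI[of _ q] exI[of _ s] exI[of _ W]) (auto simp: q_def less_imp_le)
qed

section \<open>Non-conjugate reorderings\<close>

text \<open>Beyond a threshold the slope \<open>e / 4\<close> offsets the factor 4 in the range of
  \<open>n\<close>. The finitely many smaller integers contribute a constant \<open>K\<close>, which
  \<open>e * h\<close> exceeds for large \<open>h\<close>.\<close>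

lemma sublinear_bound:
  fixes e :: real
  assumes "sublinear \<omega>" "0 < e"
  shows "\<exists>R::int. \<forall>h\<ge>R. \<forall>n::int. \<bar>n\<bar> \<le> 4 * h \<longrightarrow> \<omega> (real_of_int \<bar>n\<bar>) \<le> e * h"
proof -
  have "\<forall>\<^sub>F r in at_top. \<omega> r / r < e / 4"
  proof (rule order_tendstoD(2))
    show "((\<lambda>r. \<omega> r / r) \<longlongrightarrow> 0) at_top"
      using assms(1) by (simp add: sublinear_def)
  qed (use assms(2) in simp)
  then obtain r0 where r0: "\<And>r. r0 \<le> r \<Longrightarrow> \<omega> r / r < e / 4"
    by (auto simp: eventually_at_top_linorder)
  define N where "N = max 1 \<lceil>r0\<rceil>"
  define K where "K = Max ((\<lambda>n. \<omega> (real_of_int n)) ` {0..N})"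
  have small: "\<omega> (real_of_int n) \<le> K" if "0 \<le> n" "n \<le> N" for n
    unfolding K_def using that by (intro Max_ge) auto
  have large: "\<omega> (real_of_int n) \<le> e / 4 * n" if "N \<le> n" for n
  proof -
    have "r0 \<le> real_of_int n" "0 < real_of_int n"
      using that unfolding N_def by (auto simp: ceiling_le_iff)
    with r0[of n] show ?thesis by (simp add: field_simps)
  qed
  show ?thesis
  proof (intro exI allI impI)
    fix h n :: int assume h: "\<lceil>K / e\<rceil> \<le> h" and n: "\<bar>n\<bar> \<le> 4 * h"
    show "\<omega> (real_of_int \<bar>n\<bar>) \<le> e * h"
    proof (cases "\<bar>n\<bar> \<le> N")
      case True
      then have "\<omega> (real_of_int \<bar>n\<bar>) \<le> K" by (intro small) auto
      also have "K \<le> e * h"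
        using h \<open>0 < e\<close> by (simp add: ceiling_le_iff field_simps)
      finally show ?thesis .
    next
      case False
      then have "\<omega> (real_of_int \<bar>n\<bar>) \<le> e / 4 * real_of_int \<bar>n\<bar>" by (intro large) auto
      also have "\<dots> \<le> e / 4 * real_of_int (4 * h)"
        using n \<open>0 < e\<close> by (intro mult_left_mono) (simp only: of_int_le_iff, simp)
      finally show ?thesis by simp
    qed
  qed
qed

lemma alternating_set_conjugate:
  assumes "conjugate M S N T" and T [measurable]: "T \<in> measurable N N"
    and S [measurable]: "S \<in> measurable M M" and SM: "distr M M S = M"
    and A [measurable]: "A \<in> sets M" and alt: "AE x in M. S x \<in> A \<longleftrightarrow> x \<notin> A"
  shows "\<exists>B\<in>sets N. AE y in N. T y \<in> B \<longleftrightarrow> y \<notin> B"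
proof -
  obtain f g where [measurable]: "f \<in> measurable M N" "g \<in> measurable N M"
    and N: "distr M N f = N" and gf: "AE x in M. g (f x) = x"
    and conj: "AE x in M. f (S x) = T (f x)"
    using assms(1) unfolding conjugate_def measure_iso_def by blast
  define B where "B = g -` A \<inter> space N"
  have [measurable]: "B \<in> sets N"
    unfolding B_def by measurable
  \<comment> \<open>The identity \<open>g (f x) = x\<close> is also required at the point
    \<open>S x\<close>, and it carries over because \<open>S\<close> preserves the measure.\<close>
  have "AE x in distr M M S. g (f x) = x"
    using gf by (subst SM)
  then have "AE x in M. g (f (S x)) = S x"
    by (rule AE_distrD[rotated]) simp
  with gf conj alt AE_space have "AE x in M. T (f x) \<in> B \<longleftrightarrow> f x \<notin> B"
  proof eventually_elim
    case (elim x)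
    have "f x \<in> space N" "T (f x) \<in> space N"
      using elim by (auto intro!: measurable_space[OF T] measurable_space[OF \<open>f \<in> measurable M N\<close>])
    then show ?case
      using elim by (metis B_def IntI IntD1 vimage_eq)
  qed
  then have "AE y in distr M N f. T y \<in> B \<longleftrightarrow> y \<notin> B"
    by (subst AE_distr_iff) auto
  then have "AE y in N. T y \<in> B \<longleftrightarrow> y \<notin> B"
    by (simp only: N)
  then show ?thesis
    using \<open>B \<in> sets N\<close> by blast
qed

theorem theoremB:
  fixes M :: "'a measure" and S :: "'a \<Rightarrow> 'a" and \<omega> :: "real \<Rightarrow> real"
  assumes "standard_nonatomic_prob_space M"
    and "S \<in> Aut M"
    and "ergodic M S"
    and "\<And>n::nat. n \<ge> 2 \<Longrightarrow> \<not> ergodic M (S ^^ n)"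
    and "sublinear \<omega>"
  shows "\<exists>T\<in>Aut M. integrably_orbit_equivalent \<omega> M S M T \<and> \<not> flip_conjugate M S M T"
proof -
  have "prob_space M" and borel: "standard_borel M"
    using assms(1) by (auto simp: standard_nonatomic_prob_space_def)
  then interpret int_action M "int_iter M S"
    using assms(2) by (intro int_action_int_iter)
  have S1: "int_iter M S 1 = S"
    by (simp add: int_iter_def)
  have coloring: "\<exists>W c. cyclic_coloring p W c" if "prime p" for p
  proof (rule cyclic_coloring_exists[OF _ that])
    show "ergodic M (int_iter M S 1)"
      using assms(3) by (simp only: S1)
    show "\<not> ergodic M (int_iter M S (int p))"
      using assms(4)[OF prime_ge_2_nat[OF that]] by (simp add: int_iter_def)
  qed
  have "\<forall>k. \<exists>R::int. \<forall>h\<ge>R. \<forall>n::int. \<bar>n\<bar> \<le> 4 * h \<longrightarrow> \<omega> (real_of_int \<bar>n\<bar>) \<le> (1/2) ^ k * h"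
    using sublinear_bound[OF assms(5)] by simp
  then obtain R :: "nat \<Rightarrow> int" where R: "\<And>k h n. R k \<le> h \<Longrightarrow> \<bar>n\<bar> \<le> 4 * h \<Longrightarrow>
      \<omega> (real_of_int \<bar>n\<bar>) \<le> (1/2) ^ k * h"
    by metis
  obtain q s W where qsW: "odometer_factor M (int_iter M S) q s W" and q: "\<And>k. R (Suc k) \<le> q k"
    using odometer_factor_exists[OF coloring, of "\<lambda>k. R (Suc k)"] by blast
  interpret odometer_factor M "int_iter M S" q s W by (rule qsW)
  \<comment> \<open>For positive \<open>k\<close>, \<open>h k\<close> is a multiple of
    \<open>q (k - 1)\<close>, hence at least \<open>R k\<close>. Since \<open>h 0 = 1\<close> cannot
    be enlarged, level 0 uses the maximum of \<open>\<omega>\<close> over the integers up to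
    4.\<close>
  define b where "b k = (if k = 0 then Max ((\<lambda>n. \<omega> (real_of_int n)) ` {0..4}) else (1/2) ^ k * h k)" for k
  have b: "\<omega> (real_of_int \<bar>n\<bar>) \<le> b k" if n: "\<bar>n\<bar> \<le> 4 * h k" for k n
  proof (cases k)
    case 0
    then show ?thesis
      using n by (auto simp: b_def intro!: Max_ge image_eqI[of _ _ "\<bar>n\<bar>"])
  next
    case (Suc l)
    have "1 * q l \<le> h l * q l"
      using q_ge[of l] h_pos[of l] by (intro mult_right_mono) linarith+
    then have "R k \<le> h k"
      using q[of l] by (simp add: Suc h_Suc)
    then show ?thesis
      using R[OF _ n, of k] by (simp add: b_def Suc)
  qed
  have b_nonneg: "0 \<le> b k" for k
    using b[of 0 k] assms(5) by (force simp: sublinear_def intro: order_trans)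
  have "summable (\<lambda>k. b k / h k)"
  proof (rule summable_comparison_test_ev)
    show "\<forall>\<^sub>F k in sequentially. norm (b k / h k) \<le> (1/2) ^ k"
      using eventually_gt_at_top[of 0] by eventually_elim (simp add: b_def)
  qed (rule summable_geometric, simp)
  then have oe: "integrably_orbit_equivalent \<omega> M S M (reordered E 1)" for E
    using integrably_orbit_equivalent_reordered[of \<omega> b E] b b_nonneg assms(3) by (simp add: S1)
  \<comment> \<open>Otherwise choosing an alternating set for every \<open>E\<close> would give a
    family separated by 1/7 and indexed by all sets of naturals.\<close>
  have "\<exists>E. \<forall>A\<in>sets M. \<not> (AE x in M. reordered E 1 x \<in> A \<longleftrightarrow> x \<notin> A)"
  proof (rule ccontr)
    assume "\<not> ?thesis"
    then obtain A where A: "\<And>E. A E \<in> sets M" "\<And>E. AE x in M. reordered E 1 x \<in> A E \<longleftrightarrow> x \<notin> A E"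
      by metis
    show False
    proof (rule no_separated_powerset_family[OF _ borel])
      show "finite_measure M" by (rule finite_measure_axioms)
      show "1 / 7 \<le> measure M (sym_diff (A E) (A F))" if "E \<noteq> F" for E F
        by (rule alternating_sets_far[OF that A(1) A(1) A(2) A(2)])
    qed (auto simp: A(1))
  qed
  then obtain E where E: "\<And>A. A \<in> sets M \<Longrightarrow> \<not> (AE x in M. reordered E 1 x \<in> A \<longleftrightarrow> x \<notin> A)"
    by blast
  define T where "T = reordered E 1"
  have T: "T \<in> Aut M"
    unfolding T_def by (rule reordered_Aut)
  interpret T: int_action M "reordered E" by (rule reordered_action)
  obtain V c where "cyclic_coloring 2 V c"
    using coloring[OF two_is_prime_nat] by blast
  then have V [measurable]: "V \<in> sets M" and AE_V: "AE x in M. x \<in> V"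
    and c [measurable]: "c \<in> measurable M (count_space UNIV)"
    and c2: "\<forall>x\<in>V. 0 \<le> c x \<and> c x < int 2" "\<forall>x\<in>V. \<forall>n. int_iter M S n x \<in> V"
      "\<forall>x\<in>V. \<forall>n. c (int_iter M S n x) = (c x + n) mod int 2"
    unfolding cyclic_coloring_def by simp_all
  \<comment> \<open>The points of color 0 modulo 2 are exchanged by \<open>S\<close> with almost all
    of the rest.\<close>
  define A where "A = {x\<in>space M. x \<in> V \<and> c x = 0}"
  have A: "A \<in> sets M"
    unfolding A_def by measurable
  have alt: "AE x in M. S x \<in> A \<longleftrightarrow> x \<notin> A"
    using AE_V AE_space
  proof eventually_elim
    case (elim x)
    then have S: "c (S x) = (c x + 1) mod 2" "S x \<in> V" "S x \<in> space M"
      using c2(2)[rule_format, of x 1] c2(3)[rule_format, of x 1] action_space[of x 1]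
      by (simp_all only: S1) simp_all
    have "0 \<le> c x" "c x < 2"
      using c2(1) elim by auto
    then have "c x = 0 \<or> c x = 1"
      by linarith
    then show ?case
      using elim S by (auto simp: A_def)
  qed
  have Sm: "S \<in> measurable M M" "distr M M S = M"
    using assms(2) by (auto simp: Aut_def)
  have "\<not> flip_conjugate M S M T"
  proof
    assume "flip_conjugate M S M T"
    then consider "conjugate M S M T" | "conjugate M S M (the_inv_into (space M) T)"
      by (auto simp: flip_conjugate_def)
    then show False
    proof cases
      case 1
      have "T \<in> measurable M M"
        using T by (simp add: Aut_def)
      from alternating_set_conjugate[OF 1 this Sm A alt] show False
        using E unfolding T_def by blast
    next
      case 2
      have "the_inv_into (space M) T \<in> measurable M M"
        using T by (simp add: Aut_def)
      from alternating_set_conjugate[OF 2 this Sm A alt] obtain B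
        where B: "B \<in> sets M" "AE y in M. the_inv_into (space M) T y \<in> B \<longleftrightarrow> y \<notin> B"
        by blast
      \<comment> \<open>Substituting \<open>T y\<close> for \<open>y\<close> turns alternation under
        the inverse into alternation under \<open>T\<close>.\<close>
      have "AE y in M. T y \<in> B \<longleftrightarrow> y \<notin> B"
        using T.AE_action[OF B(2), of 1] AE_space
      proof eventually_elim
        case (elim y)
        then have "the_inv_into (space M) T (T y) = y"
          unfolding T_def by (simp add: T.the_inv_action T.action_inverse)
        then show ?case
          using elim by (auto simp: T_def)
      qed
      then show False
        using E[OF B(1)] by (simp add: T_def)
    qed
  qed
  then show ?thesis
    using T oe[of E] by (auto simp: T_def)
qed

end
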